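(* Let $r>0$, $p\in(0,1)$ and let the prior be $\mu=p\,\delta_r+(1-p)\,\delta_{-r}$. Let $v$ be the value function of the problem of optimally stopping a Brownian bridge with unknown pinning point with prior $\mu$. For fixed $z\in\mathbb{R}$, the value function satisfies $$\lim_{t\nearrow1}v(t,z)=-r\,\mathbf{1}_{\{z<-r\}}+z\,\mathbf{1}_{\{-r\le z<0\}}+pr\,\mathbf{1}_{\{z=0\}}+r\,\mathbf{1}_{\{0<z\le r\}}+z\,\mathbf{1}_{\{z>r\}}.$$
   Context: For $(t,z)\in[0,1)\times\mathbb{R}$ let $$\pi(t,z):=\frac{\frac{p}{1-p}e^{\frac{2rz}{1-t}}}{\frac{p}{1-p}e^{\frac{2rz}{1-t}}+1}.$$ The posterior distribution is $\mu_{t,z}=\pi(t,z)\delta_r+(1-\pi(t,z))\delta_{-r}$, with mean $h(t,z)=r(2\pi(t,z)-1)$. The process $Z^{t,z}$ is the solution of $$dZ_{t+s}=\frac{h(t+s,Z_{t+s})-Z_{t+s}}{1-(t+s)}\,ds+d\hat W_{t+s},\quad0\le s<1-t,\qquad Z_t=z,$$ with $\hat W$ a standard Brownian motion, extended to time $1$ by its a.s. limit; equivalently, in law, it is a Brownian bridge started at time $t$ from $z$ whose (unknown) pinning point at time $1$ has distribution $\mu_{t,z}$. The value function is $$v(t,z)=\sup_{\tau\in\mathcal{T}^Z_{1-t}}\mathbb{E}[Z^{t,z}_{t+\tau}],\qquad(t,z)\in[0,1)\times\mathbb{R},$$ where $\mathcal{T}^Z_{1-t}$ is the set of $[0,1-t]$-valued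 stopping times with respect to the filtration generated by $s\mapsto Z^{t,z}_{t+s}$. *)

theory Defs
  imports "HOL-Probability.Probability"
begin

definition brownian_motion :: "'a measure \<Rightarrow> (real \<Rightarrow> 'a \<Rightarrow> real) \<Rightarrow> bool" where
  "brownian_motion M W \<longleftrightarrow>
     prob_space M \<and>
     (\<forall>s\<ge>0. W s \<in> borel_measurable M) \<and>
     (AE \<omega> in M. W 0 \<omega> = 0) \<and>
     (\<forall>\<omega>\<in>space M. continuous_on {0..} (\<lambda>s. W s \<omega>)) \<and>
     (\<forall>s u. 0 \<le> s \<and> s < u \<longrightarrow>
        distributed M lborel (\<lambda>\<omega>. W u \<omega> - W s \<omega>) (normal_density 0 (sqrt (u - s)))) \<and>
     (\<forall>n (s :: nat \<Rightarrow> real). 0 \<le> s 0 \<and> (\<forall>i<n. s i \<le> s (Suc i)) \<longrightarrow>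
        prob_space.indep_vars M (\<lambda>_. borel) (\<lambda>i \<omega>. W (s (Suc i)) \<omega> - W (s i) \<omega>) {..<n})"

text \<open>
  The posterior law of the pinning point, given that the bridge is at \<open>z\<close> at time \<open>t\<close>, puts mass
  \<open>posterior_prob r p t z\<close> on \<open>r\<close> and the remaining mass on \<open>- r\<close>; its mean is
  \<open>posterior_mean r p t z\<close>.
\<close>

definition posterior_prob :: "real \<Rightarrow> real \<Rightarrow> real \<Rightarrow> real \<Rightarrow> real" where
  "posterior_prob r p t z =
     (p / (1 - p) * exp (2 * r * z / (1 - t))) / (p / (1 - p) * exp (2 * r * z / (1 - t)) + 1)"

definition posterior_mean :: "real \<Rightarrow> real \<Rightarrow> real \<Rightarrow> real \<Rightarrow> real" where
  "posterior_mean r p t z = r * (2 * posterior_prob r p t z - 1)"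

text \<open>
  \<open>Z\<close> solves, on \<open>[t, 1)\<close> and with start \<open>z\<close> at time \<open>t\<close>, the equation
  \<open>dZ(t+s) = (h(t+s, Z(t+s)) - Z(t+s)) / (1 - (t+s)) ds + dW(s)\<close> with \<open>h = posterior_mean r p\<close>.
  The noise is additive, so the integrated form involves only a pathwise integral.  \<open>Z\<close> is indexed
  by absolute time in \<open>[t, 1]\<close> and \<open>W\<close> by elapsed time.  Paths of \<open>Z\<close> are continuous on \<open>[t, 1)\<close>;
  the value at time \<open>1\<close> is the almost sure left limit.  No filtration for \<open>W\<close> is mentioned: the
  equation expresses \<open>W\<close> through \<open>Z\<close>, and conversely, the drift being locally Lipschitz in space
  on \<open>[t, 1)\<close>, it determines \<open>Z\<close> from \<open>W\<close> path by path.
\<close>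

definition bridge_solution ::
  "real \<Rightarrow> real \<Rightarrow> real \<Rightarrow> real \<Rightarrow> 'a measure \<Rightarrow> (real \<Rightarrow> 'a \<Rightarrow> real) \<Rightarrow> (real \<Rightarrow> 'a \<Rightarrow> real) \<Rightarrow> bool" where
  "bridge_solution r p t z M W Z \<longleftrightarrow>
     brownian_motion M W \<and>
     (\<forall>u\<in>{t..1}. Z u \<in> borel_measurable M) \<and>
     (\<forall>\<omega>\<in>space M. continuous_on {t..<1} (\<lambda>u. Z u \<omega>)) \<and>
     (AE \<omega> in M. \<forall>s\<in>{0..<1 - t}.
        Z (t + s) \<omega> =
          z + integral {0..s}
                (\<lambda>u. (posterior_mean r p (t + u) (Z (t + u) \<omega>) - Z (t + u) \<omega>) / (1 - (t + u)))
            + W s \<omega>) \<and>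
     (AE \<omega> in M. ((\<lambda>u. Z u \<omega>) \<longlongrightarrow> Z 1 \<omega>) (at_left 1))"

text \<open>
  The raw filtration generated by \<open>s \<mapsto> Z (t + s)\<close>, \<open>0 \<le> s \<le> 1 - t\<close>.  The index ranges over all
  reals: the filtration is trivial at negative times and constant from time \<open>1 - t\<close> on.
\<close>

definition bridge_filtration ::
  "'a measure \<Rightarrow> real \<Rightarrow> (real \<Rightarrow> 'a \<Rightarrow> real) \<Rightarrow> real \<Rightarrow> 'a measure" where
  "bridge_filtration M t Z s =
     sigma (space M)
       {Z (t + u) -` A \<inter> space M | u A. 0 \<le> u \<and> u \<le> s \<and> u \<le> 1 - t \<and> A \<in> sets borel}"

definition bridge_stopping_times ::
  "'a measure \<Rightarrow> real \<Rightarrow> (real \<Rightarrow> 'a \<Rightarrow> real) \<Rightarrow> ('a \<Rightarrow> real) set" where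
  "bridge_stopping_times M t Z =
     {\<tau>. stopping_time (bridge_filtration M t Z) \<tau> \<and> (\<forall>\<omega>\<in>space M. \<tau> \<omega> \<in> {0..1 - t})}"

definition stopping_value :: "'a measure \<Rightarrow> real \<Rightarrow> (real \<Rightarrow> 'a \<Rightarrow> real) \<Rightarrow> real" where
  "stopping_value M t Z = (SUP \<tau>\<in>bridge_stopping_times M t Z. \<integral>\<omega>. Z (t + \<tau> \<omega>) \<omega> \<partial>M)"

end

(*
  In the clock q = 1 / (1 - u) the rescaled process Y = q Z solves dY = r tanh (r Y + c) dq + dB with
  c = 1/2 ln (p / (1 - p)). Integration by parts writes B / q in terms of W, so that path by path the
  noise in Z is at most twice the maximum of |W| over the remaining time, which is O(sqrt (1 - t)) in
  mean. If z is not 0, then Y starts far from 0, the drift keeps the sign of z up to an event of small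
  probability, and Z is squeezed between explicit paths; stopping at once or at time 1 is optimal in the limit.
  If z = 0, the observer waits for a small fraction of the remaining time. The generator of Y
  annihilates tanh (r y + c), hence the posterior probability of r keeps mean p, and it multiplies
  sech (r y + c) by - r^2 / 2, so that after this wait Y is far from 0 with high probability. These
  two expectations come from the Euler scheme of the equation. Afterwards the case of nonzero start
  applies: continue if Y is positive and stop (near 0) if it is negative, which yields p r.
*)

theory Submission
  imports Defs
begin

text \<open>Given the pinning point r or - r, the process Y in the clock q is a Brownian motion with
  drift r or - r. Mixing the two yields the Doob transform of Brownian motion by h(y) = cosh (r y +
  c), whose drift h'/h is r tanh (r y + c). Its generator sends f to (h f)'' / (2 h) - r^2 f / 2.
  This explains both eigenfunctions: for f = tanh (r y + c) the product h f is sinh (r y + c), which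
  solves u'' = r^2 u, and for f = sech (r y + c) it is constant. The processes for different t may
  live on unrelated probability spaces, so every estimate is quantitative, with errors of order sqrt
  (1 - t) or exp (- b / (1 - t)). Path estimates are deterministic statements about one trajectory
  and a bound R on its noise; probability enters through the mean of R and the two expectations.
  Upper bounds on the value control the whole path, hence even an observer who foresees it. Lower
  bounds use three explicit rules: stop at once, wait until time 1, or look once at the sign of
  Z.\<close>

section \<open>Maximal inequality for Brownian motion\<close>

lemma (in prob_space) centered_normal_moments:
  assumes X: "distributed M lborel X (normal_density 0 \<sigma>)" and \<sigma>: "0 < \<sigma>"
  shows "integrable M (\<lambda>\<omega>. X \<omega> ^ k)"
    and "expectation X = 0" and "expectation (\<lambda>\<omega>. X \<omega> ^ 2) = \<sigma>\<^sup>2"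
    and "expectation (\<lambda>\<omega>. X \<omega> ^ 4) = 3 * \<sigma> ^ 4"
proof -
  have transfer: "expectation (\<lambda>\<omega>. X \<omega> ^ j) = (\<integral>x. normal_density 0 \<sigma> x * x ^ j \<partial>lborel)" for j
    by (subst distributed_integral[OF X, symmetric]) auto
  show "integrable M (\<lambda>\<omega>. X \<omega> ^ k)"
    using integrable_normal_moment[OF \<sigma>, of 0 k] distributed_integrable[OF X, of "\<lambda>x. x ^ k"] by simp
  show "expectation X = 0"
    using transfer[of 1] integral_normal_moment_odd[OF \<sigma>, of 0 0] by simp
  show "expectation (\<lambda>\<omega>. X \<omega> ^ 2) = \<sigma>\<^sup>2"
    using transfer[of 2] integral_normal_moment_even[OF \<sigma>, of 0 1] by simp
  show "expectation (\<lambda>\<omega>. X \<omega> ^ 4) = 3 * \<sigma> ^ 4"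
    using transfer[of 4] integral_normal_moment_even[OF \<sigma>, of 0 2]
    by (simp add: fact_numeral field_simps power_divide flip: power_mult)
qed

lemma brownian_motion_increment:
  assumes "brownian_motion M W" "0 \<le> s" "s < u"
  shows "distributed M lborel (\<lambda>\<omega>. W u \<omega> - W s \<omega>) (normal_density 0 (sqrt (u - s)))"
  using assms unfolding brownian_motion_def by blast

text \<open>An odd node of level \<open>Suc n\<close> is reached by one increment from its even left
  neighbour, which is already a node of level \<open>n\<close>. So every level is paid for at most
  once.\<close>

lemma dyadic_increments_bound:
  fixes g :: "real \<Rightarrow> real"
  assumes inc: "\<And>n k. k < 2 ^ n \<Longrightarrow> \<bar>g (T * (real k + 1) / 2 ^ n) - g (T * real k / 2 ^ n)\<bar> \<le> m n"
    and "k \<le> 2 ^ n"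
  shows "\<bar>g (T * real k / 2 ^ n) - g 0\<bar> \<le> (\<Sum>j\<le>n. m j)"
  using \<open>k \<le> 2 ^ n\<close>
proof (induction n arbitrary: k)
  case 0
  then have "k = 0 \<or> k = 1" by auto
  then show ?case using inc[of 0 0] by auto
next
  case (Suc n)
  define i where "i = k div 2"
  have "0 \<le> m (Suc n)" using inc[of 0 "Suc n"] by simp
  have "i \<le> 2 ^ n" using Suc.prems by (simp add: i_def)
  then have IH: "\<bar>g (T * real (2 * i) / 2 ^ Suc n) - g 0\<bar> \<le> (\<Sum>j\<le>n. m j)"
    using Suc.IH[of i] by simp
  show ?case
  proof (cases "even k")
    case True
    then have "k = 2 * i" by (simp add: i_def)
    then show ?thesis using IH \<open>0 \<le> m (Suc n)\<close> by simp
  next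
    case False
    then have k: "k = 2 * i + 1" by (simp add: i_def)
    then have "\<bar>g (T * real k / 2 ^ Suc n) - g (T * real (2 * i) / 2 ^ Suc n)\<bar> \<le> m (Suc n)"
      using inc[of "2 * i" "Suc n"] Suc.prems by (simp add: add.commute)
    then show ?thesis using IH by simp
  qed
qed

text \<open>The left dyadic neighbours of \<open>s\<close> converge to \<open>s\<close>, and the
  bound over finitely many levels passes to the limit by continuity.\<close>

lemma continuous_dyadic_increments_bound:
  fixes g :: "real \<Rightarrow> real"
  assumes "0 < T" and cont: "continuous_on {0..T} g" and m: "summable m"
    and inc: "\<And>n k. k < 2 ^ n \<Longrightarrow> \<bar>g (T * (real k + 1) / 2 ^ n) - g (T * real k / 2 ^ n)\<bar> \<le> m n"
    and s: "s \<in> {0..T}"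
  shows "\<bar>g s - g 0\<bar> \<le> suminf m"
proof -
  have m0: "0 \<le> m n" for n using inc[of 0 n] by simp
  define k where "k n = nat \<lfloor>2 ^ n * (s / T)\<rfloor>" for n
  define x where "x n = T * real (k n) / 2 ^ n" for n
  have k: "real (k n) \<le> 2 ^ n * (s / T)" "2 ^ n * (s / T) < real (k n) + 1" for n
    using s \<open>0 < T\<close> by (auto simp: k_def floor_less_iff)
  have xs: "x n \<le> s" "s - T / 2 ^ n \<le> x n" "0 \<le> x n" for n
  proof -
    have T: "0 < T / 2 ^ n" using \<open>0 < T\<close> by simp
    have eq: "T / 2 ^ n * (2 ^ n * (s / T)) = s" "x n = T / 2 ^ n * real (k n)"
      using \<open>0 < T\<close> by (simp_all add: x_def)
    show "x n \<le> s" using mult_left_mono[OF k(1)[of n] less_imp_le[OF T]] eq by simp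
    show "s - T / 2 ^ n \<le> x n"
      using mult_strict_left_mono[OF k(2)[of n] T] eq by (simp only: distrib_left)
    show "0 \<le> x n" using \<open>0 < T\<close> by (simp add: x_def)
  qed
  have "k n \<le> 2 ^ n" for n
  proof -
    have "2 ^ n * (s / T) \<le> 2 ^ n" using s \<open>0 < T\<close> by (intro mult_left_le) auto
    with k(1)[of n] have "real (k n) \<le> 2 ^ n" by (rule order_trans)
    then show ?thesis by simp
  qed
  then have bound: "\<bar>g (x n) - g 0\<bar> \<le> suminf m" for n
    using dyadic_increments_bound[of g T m, OF inc] sum_le_suminf[OF m, of "{..n}"] m0
    unfolding x_def by (meson finite_atMost order_trans)
  have "(\<lambda>n. s - T * (1 / 2) ^ n) \<longlonglongrightarrow> s - T * 0"
    by (intro tendsto_intros LIMSEQ_realpow_zero) auto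
  then have "x \<longlonglongrightarrow> s"
    using xs by (intro tendsto_sandwich[of "\<lambda>n. s - T * (1 / 2) ^ n" x sequentially "\<lambda>_. s"])
      (auto simp: power_divide)
  then have "(\<lambda>n. g (x n)) \<longlonglongrightarrow> g s"
    using xs s by (intro continuous_on_tendsto_compose[OF cont]) (auto intro!: always_eventually intro: order_trans)
  then have "(\<lambda>n. \<bar>g (x n) - g 0\<bar>) \<longlonglongrightarrow> \<bar>g s - g 0\<bar>"
    by (intro tendsto_intros)
  then show ?thesis using bound by (intro LIMSEQ_le_const2) auto
qed

text \<open>
  Chaining over dyadic intervals: at level \<open>n\<close> the largest of the \<open>2 ^ n\<close> increments \<open>D\<close> is at most
  \<open>e n + (\<Sum>D. D ^ 4) / e n ^ 3\<close>, and \<open>e n = (9 / 10) ^ n * sqrt T\<close> makes the expectations summable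
  because \<open>2 * (9 / 10) ^ 4 > 1\<close>.
\<close>

lemma brownian_motion_maximal:
  assumes bm: "brownian_motion M W" and T: "0 < T"
  obtains R where "integrable M R" "\<And>\<omega>. 0 \<le> R \<omega>" "(\<integral>\<omega>. R \<omega> \<partial>M) \<le> 40 * sqrt T"
    "AE \<omega> in M. \<forall>s\<in>{0..T}. \<bar>W s \<omega>\<bar> \<le> R \<omega>"
proof -
  interpret prob_space M using bm by (simp add: brownian_motion_def)
  define e :: "nat \<Rightarrow> real" where "e n = sqrt T * (9 / 10) ^ n" for n
  have e: "0 < e n" for n using T by (simp add: e_def)
  define D where "D n k \<omega> = W (T * (real k + 1) / 2 ^ n) \<omega> - W (T * real k / 2 ^ n) \<omega>" for n k \<omega>
  define f where "f n \<omega> = e n + (\<Sum>k<2 ^ n. D n k \<omega> ^ 4) / e n ^ 3" for n \<omega>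
  have f0: "0 \<le> f n \<omega>" for n \<omega>
    using e[of n] by (auto simp: f_def intro!: add_nonneg_nonneg divide_nonneg_nonneg sum_nonneg)
  have D: "distributed M lborel (D n k) (normal_density 0 (sqrt (T / 2 ^ n)))" for n k
  proof -
    from brownian_motion_increment[OF bm, of "T * real k / 2 ^ n" "T * (real k + 1) / 2 ^ n"] show ?thesis
      using T by (simp add: D_def[abs_def] divide_strict_right_mono algebra_simps flip: diff_divide_distrib)
  qed
  have sd: "0 < sqrt (T / 2 ^ n)" for n :: nat using T by simp
  have intD: "integrable M (\<lambda>\<omega>. D n k \<omega> ^ 4)" for n k
    by (rule centered_normal_moments(1)[OF D sd])
  have intf: "integrable M (f n)" for n
    unfolding f_def[abs_def] using intD by auto
  have Ef: "expectation (f n) \<le> 4 * e n" for n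
  proof -
    have "expectation (f n) = e n + 2 ^ n * (3 * (T / 2 ^ n)\<^sup>2) / e n ^ 3"
      unfolding f_def[abs_def] using intD T centered_normal_moments(4)[OF D sd, of n]
      by (simp add: prob_space real_sqrt_power_even)
    also have "2 ^ n * (3 * (T / 2 ^ n)\<^sup>2) / e n ^ 3 \<le> 3 * e n"
    proof -
      have "1 \<le> (2 * (9 / 10) ^ 4 :: real) ^ n" by (intro one_le_power) (simp add: power_divide)
      also have "\<dots> = 2 ^ n * ((9 / 10) ^ n) ^ 4" by (simp add: power_mult_distrib flip: power_mult) (simp add: mult.commute)
      finally have "T\<^sup>2 \<le> T\<^sup>2 * (2 ^ n * ((9 / 10) ^ n) ^ 4)" using T by simp
      also have "\<dots> = 2 ^ n * e n ^ 4" using T by (simp add: e_def power_mult_distrib real_sqrt_power_even)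
      finally have "T\<^sup>2 / 2 ^ n \<le> e n ^ 4" by (simp add: field_simps)
      then have "3 * (T\<^sup>2 / 2 ^ n) / e n ^ 3 \<le> 3 * e n ^ 4 / e n ^ 3"
        using e[of n] by (intro divide_right_mono) auto
      also have "3 * e n ^ 4 / e n ^ 3 = 3 * e n" using e[of n] by (simp add: power_numeral_reduce)
      also have "2 ^ n * (3 * (T / 2 ^ n)\<^sup>2) = 3 * (T\<^sup>2 / 2 ^ n)" by (simp add: power2_eq_square field_simps)
      ultimately show ?thesis by simp
    qed
    finally show ?thesis by simp
  qed
  \<comment> \<open>Each level costs \<open>e n\<close> plus at most \<open>3 * e n\<close>, and the
    geometric series with ratio 9/10 sums to 10. This is the origin of the constant 40.\<close>
  have es: "(\<lambda>n. 4 * e n) sums (40 * sqrt T)"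
    using sums_mult[OF geometric_sums[of "9 / 10 :: real"], of "4 * sqrt T"] by (simp add: e_def mult_ac)
  \<comment> \<open>The series is formed in \<open>ennreal\<close>, because its almost sure
    convergence follows only from the bound on its mean.\<close>
  define S where "S \<omega> = (\<Sum>n. ennreal (f n \<omega>))" for \<omega>
  have [measurable]: "f n \<in> borel_measurable M" for n using intf by auto
  have Sm[measurable]: "S \<in> borel_measurable M" unfolding S_def by measurable
  have S: "(\<integral>\<^sup>+\<omega>. S \<omega> \<partial>M) \<le> ennreal (40 * sqrt T)"
  proof -
    have "(\<integral>\<^sup>+\<omega>. S \<omega> \<partial>M) = (\<Sum>n. \<integral>\<^sup>+\<omega>. ennreal (f n \<omega>) \<partial>M)"
      unfolding S_def by (rule nn_integral_suminf) measurable
    moreover have "(\<integral>\<^sup>+\<omega>. ennreal (f n \<omega>) \<partial>M) \<le> ennreal (4 * e n)" for n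
      using Ef[of n] by (subst nn_integral_eq_integral) (auto simp: intf f0 ennreal_leI)
    then have "(\<Sum>n. \<integral>\<^sup>+\<omega>. ennreal (f n \<omega>) \<partial>M) \<le> (\<Sum>n. ennreal (4 * e n))"
      by (rule suminf_le) auto
    moreover have "(\<Sum>n. ennreal (4 * e n)) = ennreal (40 * sqrt T)"
    proof (subst suminf_ennreal2)
      show "0 \<le> 4 * e n" for n using e[of n] by simp
      show "summable (\<lambda>n. 4 * e n)" using es by (rule sums_summable)
      show "ennreal (\<Sum>n. 4 * e n) = ennreal (40 * sqrt T)" using sums_unique[OF es] by (simp only:)
    qed
    ultimately show ?thesis by (simp only:)
  qed
  \<comment> \<open>\<open>enn2real\<close> makes \<open>R\<close> real everywhere; it is 0 where
    the series diverges, a null set that the final bound excludes.\<close>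
  define R where "R \<omega> = enn2real (S \<omega>)" for \<omega>
  have fin: "AE \<omega> in M. S \<omega> \<noteq> \<infinity>"
    using S by (intro nn_integral_noteq_infinite) (auto simp: top_unique)
  have "(\<integral>\<^sup>+\<omega>. ennreal (R \<omega>) \<partial>M) = (\<integral>\<^sup>+\<omega>. S \<omega> \<partial>M)"
    using fin by (intro nn_integral_cong_AE) (auto simp: R_def less_top)
  with S have R: "(\<integral>\<^sup>+\<omega>. ennreal (R \<omega>) \<partial>M) \<le> ennreal (40 * sqrt T)" by simp
  have R0: "0 \<le> R \<omega>" for \<omega> by (simp add: R_def)
  have Rm[measurable]: "R \<in> borel_measurable M" unfolding R_def by measurable
  have intR: "integrable M R"
    using R R0 by (intro integrableI_nonneg) (auto simp: le_less_trans)
  have "AE \<omega> in M. W 0 \<omega> = 0" using bm by (simp add: brownian_motion_def)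
  with fin have "AE \<omega> in M. \<forall>s\<in>{0..T}. \<bar>W s \<omega>\<bar> \<le> R \<omega>"
  using AE_space[of M]
  proof eventually_elim
    case (elim \<omega>)
    show ?case
    proof
      fix s assume s: "s \<in> {0..T}"
      have summ: "summable (\<lambda>n. f n \<omega>)"
        using elim(1) f0 by (intro summable_suminf_not_top) (auto simp: S_def)
      have "\<bar>W (T * (real k + 1) / 2 ^ n) \<omega> - W (T * real k / 2 ^ n) \<omega>\<bar> \<le> f n \<omega>" if "k < 2 ^ n" for n k
      proof -
        define x where "x = \<bar>D n k \<omega>\<bar>"
        \<comment> \<open>If \<open>x\<close> exceeds \<open>e n\<close>, then the second term alone
          suffices. In this way a maximum over increments is replaced by a sum of fourth
          powers.\<close>
        have "x \<le> e n + x ^ 4 / e n ^ 3"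
        proof (cases "x \<le> e n")
          case False
          then have "x * e n ^ 3 \<le> x * x ^ 3"
            using e[of n] by (intro mult_left_mono power_mono) auto
          then have "x \<le> x ^ 4 / e n ^ 3" using e[of n] by (simp add: field_simps power_numeral_reduce)
          then show ?thesis using e[of n] by simp
        qed (use e[of n] in \<open>auto simp: x_def intro!: add_increasing2\<close>)
        also have "x ^ 4 \<le> (\<Sum>k<2 ^ n. D n k \<omega> ^ 4)"
          using member_le_sum[of k "{..<2 ^ n}" "\<lambda>k. D n k \<omega> ^ 4"] that by (simp add: x_def)
        finally show ?thesis using e[of n] by (simp add: x_def f_def D_def divide_right_mono)
      qed
      then have "\<bar>W s \<omega> - W 0 \<omega>\<bar> \<le> (\<Sum>n. f n \<omega>)"
        using bm s elim
        by (intro continuous_dyadic_increments_bound[of T "\<lambda>s. W s \<omega>", OF T _ summ])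
          (auto simp: brownian_motion_def intro: continuous_on_subset)
      moreover have "R \<omega> = (\<Sum>n. f n \<omega>)"
        unfolding R_def S_def using suminf_ennreal2[OF f0 summ] f0
        by (simp add: suminf_nonneg[OF summ])
      ultimately show "\<bar>W s \<omega>\<bar> \<le> R \<omega>" using elim by simp
    qed
  qed
  moreover have "expectation R \<le> 40 * sqrt T"
    using R R0 T by (simp add: nn_integral_eq_integral intR)
  ultimately show thesis using that intR R0 by blast
qed

section \<open>The equation path by path\<close>

text \<open>Here \<open>w\<close> is the noise of Z read in the clock q, so the equation is dY = r
  tanh (r Y + c) dq + q dw. Since d(q w) = q dw + w dq, subtracting q w leaves an ordinary
  derivative, and the equation makes sense for a single path.\<close>

definition drift_path :: "real \<Rightarrow> real \<Rightarrow> real \<Rightarrow> (real \<Rightarrow> real) \<Rightarrow> (real \<Rightarrow> real) \<Rightarrow> bool" where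
  "drift_path r c a w Y \<longleftrightarrow> continuous_on {a..} w \<and> continuous_on {a..} Y \<and>
     (\<forall>q\<ge>a. ((\<lambda>q. Y q - q * w q) has_real_derivative r * tanh (r * Y q + c) - w q) (at q within {a..}))"

text \<open>As tanh is odd, a reflected path is of the same kind, with shift \<open>- c\<close>. The
  bounds \<open>drift_path_upper\<close> and \<open>drift_path_stays_below\<close> are reflections
  of lower bounds.\<close>

lemma drift_path_minus:
  assumes "drift_path r c a w Y"
  shows "drift_path r (- c) a (\<lambda>q. - w q) (\<lambda>q. - Y q)"
proof -
  have "((\<lambda>q. - Y q - q * - w q) has_real_derivative r * tanh (r * - Y q + - c) - - w q) (at q within {a..})"
    if "a \<le> q" for q
  proof -
    have "((\<lambda>q. - (Y q - q * w q)) has_real_derivative - (r * tanh (r * Y q + c) - w q)) (at q within {a..})"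
      using assms that unfolding drift_path_def by (intro DERIV_minus) auto
    moreover have "tanh (r * - Y q + - c) = - tanh (r * Y q + c)"
      using tanh_minus[of "r * Y q + c"] by simp
    ultimately show ?thesis by simp
  qed
  then show ?thesis using assms by (auto simp: drift_path_def intro: continuous_on_minus)
qed

text \<open>Mean value theorem for the differentiable part \<open>Y q - q * w q\<close>: the drift
  is evaluated at one intermediate clock time instead of being integrated.\<close>

lemma drift_path_increment:
  assumes path: "drift_path r c a w Y" and "a \<le> q1" "q1 < q2"
  obtains x where "x \<in> {q1<..<q2}"
    "Y q2 - Y q1 = q2 * w q2 - q1 * w q1 + (q2 - q1) * (r * tanh (r * Y x + c) - w x)"
proof -
  have "\<exists>x\<in>{q1<..<q2}. (Y q2 - q2 * w q2) - (Y q1 - q1 * w q1)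
      = (\<lambda>h. h * (r * tanh (r * Y x + c) - w x)) (q2 - q1)"
  proof (rule mvt_simple[OF \<open>q1 < q2\<close>])
    fix x assume "q1 \<le> x" "x \<le> q2"
    then have "((\<lambda>q. Y q - q * w q) has_real_derivative r * tanh (r * Y x + c) - w x) (at x within {a..})"
      using path \<open>a \<le> q1\<close> by (simp add: drift_path_def)
    then have "((\<lambda>q. Y q - q * w q) has_real_derivative r * tanh (r * Y x + c) - w x) (at x within {q1..q2})"
      by (rule DERIV_subset) (use \<open>a \<le> q1\<close> in auto)
    then show "((\<lambda>q. Y q - q * w q) has_derivative (\<lambda>h. h * (r * tanh (r * Y x + c) - w x))) (at x within {q1..q2})"
      by (simp add: has_field_derivative_def mult.commute[of _ "r * tanh (r * Y x + c) - w x"])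
  qed
  then show thesis using that by (auto simp: algebra_simps)
qed

text \<open>The noise contributes \<open>q2 * w q2\<close>, \<open>- q1 * w q1\<close> and
  \<open>- (q2 - q1) * w x\<close>, in size at most R (q2 + q1 + (q2 - q1)) = 2 R q2.\<close>

lemma drift_path_ge:
  assumes path: "drift_path r c a w Y" and "a \<le> q1" "0 \<le> q1" "q1 \<le> q2"
    and w: "\<And>q. a \<le> q \<Longrightarrow> \<bar>w q\<bar> \<le> R"
    and drift: "\<And>x. q1 < x \<Longrightarrow> x < q2 \<Longrightarrow> \<rho> \<le> r * tanh (r * Y x + c)"
  shows "Y q1 + \<rho> * (q2 - q1) - 2 * R * q2 \<le> Y q2"
proof (cases "q1 = q2")
  case True
  have "0 \<le> R" using w[of a] by simp
  then show ?thesis using True assms by simp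
next
  case False
  then obtain x where x: "q1 < x" "x < q2"
    "Y q2 - Y q1 = q2 * w q2 - q1 * w q1 + (q2 - q1) * (r * tanh (r * Y x + c) - w x)"
    using drift_path_increment[OF path \<open>a \<le> q1\<close>, of q2] \<open>q1 \<le> q2\<close> by auto
  have "- R \<le> w q2" "w q1 \<le> R"
    using w[of q1] w[of q2] \<open>a \<le> q1\<close> \<open>q1 \<le> q2\<close> by (simp_all add: abs_le_iff)
  then have "q2 * - R \<le> q2 * w q2" "q1 * w q1 \<le> q1 * R"
    using \<open>0 \<le> q1\<close> \<open>q1 \<le> q2\<close> mult_left_mono[of "- R" "w q2" q2] mult_left_mono[of "w q1" R q1]
    by auto
  moreover have "(q2 - q1) * (\<rho> - R) \<le> (q2 - q1) * (r * tanh (r * Y x + c) - w x)"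
  proof (intro mult_left_mono diff_mono)
    show "w x \<le> R" using w[of x] x(1) \<open>a \<le> q1\<close> by linarith
  qed (use drift[of x] x in auto)
  ultimately have "q2 * - R - q1 * R + (q2 - q1) * (\<rho> - R) \<le> Y q2 - Y q1"
    unfolding x(3) by linarith
  then show ?thesis by (simp add: algebra_simps)
qed

lemma drift_path_lower:
  assumes path: "drift_path r c a w Y" and "0 \<le> r" "a \<le> q1" "0 \<le> q1" "q1 \<le> q2"
    and w: "\<And>q. a \<le> q \<Longrightarrow> \<bar>w q\<bar> \<le> R"
  shows "Y q1 - r * (q2 - q1) - 2 * R * q2 \<le> Y q2"
proof -
  have "r * - 1 \<le> r * tanh (r * Y x + c)" for x
    using tanh_real_gt_neg1[of "r * Y x + c"] \<open>0 \<le> r\<close> by (intro mult_left_mono) auto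
  then show ?thesis
    using drift_path_ge[OF path \<open>a \<le> q1\<close> \<open>0 \<le> q1\<close> \<open>q1 \<le> q2\<close> w, where \<rho> = "- r"] by simp
qed

lemma drift_path_upper:
  assumes path: "drift_path r c a w Y" and "0 \<le> r" "a \<le> q1" "0 \<le> q1" "q1 \<le> q2"
    and w: "\<And>q. a \<le> q \<Longrightarrow> \<bar>w q\<bar> \<le> R"
  shows "Y q2 \<le> Y q1 + r * (q2 - q1) + 2 * R * q2"
  using drift_path_lower[OF drift_path_minus[OF path] assms(2-5), of R] w by simp

text \<open>A first-exit argument. Above the level \<open>l\<close> the drift is at least
  \<open>\<rho>\<close>, so \<open>drift_path_ge\<close> applies until \<open>Y\<close> first
  reaches \<open>l\<close>; by \<open>large\<close> its lower bound is still strictly above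
  \<open>l\<close> at that time, so the level is never reached.\<close>

lemma drift_path_stays_above:
  assumes path: "drift_path r c a w Y" and "a \<le> q1" "0 \<le> q1" "q1 \<le> q"
    and w: "\<And>q. a \<le> q \<Longrightarrow> \<bar>w q\<bar> \<le> R"
    and drift: "\<And>y. l \<le> y \<Longrightarrow> \<rho> \<le> r * tanh (r * y + c)"
    and start: "\<eta> * q1 \<le> Y q1"
    and large: "0 \<le> min \<eta> \<rho> - 2 * R" "l < (min \<eta> \<rho> - 2 * R) * q1"
  shows "\<eta> * q1 + \<rho> * (q - q1) - 2 * R * q \<le> Y q"
proof -
  have "l < Y x" if "q1 \<le> x" for x
  proof (rule ccontr)
    assume "\<not> l < Y x"
    define S where "S = {q1..x} \<inter> Y -` {..l}"
    have "continuous_on {q1..x} Y"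
      using path \<open>a \<le> q1\<close> by (auto simp: drift_path_def elim: continuous_on_subset)
    then have "closed S" unfolding S_def by (intro continuous_closed_preimage) auto
    moreover have "S \<subseteq> {q1..x}" "x \<in> S" using that \<open>\<not> l < Y x\<close> by (auto simp: S_def)
    ultimately obtain s where s: "s \<in> S" "\<And>y. y \<in> S \<Longrightarrow> s \<le> y"
      using compact_attains_inf[of S] bounded_subset[OF bounded_closed_interval]
      by (metis compact_eq_bounded_closed empty_iff)
    then have sq: "q1 \<le> s" "Y s \<le> l" by (auto simp: S_def)
    have "\<rho> \<le> r * tanh (r * Y y + c)" if "q1 < y" "y < s" for y
    proof (rule drift)
      have "y \<notin> S" using s(2)[of y] that by auto
      then show "l \<le> Y y" using s(1) that by (auto simp: S_def)
    qed
    then have "Y q1 + \<rho> * (s - q1) - 2 * R * s \<le> Y s"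
      using drift_path_ge[OF path \<open>a \<le> q1\<close> \<open>0 \<le> q1\<close> sq(1) w] by blast
    \<comment> \<open>Initial slope and drift are both replaced by their minimum, so that the lower
      bound is proportional to \<open>s\<close> and does not decrease after
      \<open>q1\<close>.\<close>
    moreover have "min \<eta> \<rho> * q1 \<le> \<eta> * q1" "min \<eta> \<rho> * (s - q1) \<le> \<rho> * (s - q1)"
      using sq \<open>0 \<le> q1\<close> by (intro mult_right_mono; simp)+
    moreover have "(min \<eta> \<rho> - 2 * R) * q1 \<le> (min \<eta> \<rho> - 2 * R) * s"
      using sq large by (intro mult_left_mono) auto
    ultimately show False using sq start large(2) by (simp add: algebra_simps)
  qed
  then have "Y q1 + \<rho> * (q - q1) - 2 * R * q \<le> Y q"
    using assms by (intro drift_path_ge[OF path] drift) (auto intro: less_imp_le)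
  then show ?thesis using start by linarith
qed

lemma drift_path_stays_below:
  assumes path: "drift_path r c a w Y" and q: "a \<le> q1" "0 \<le> q1" "q1 \<le> q"
    and w: "\<And>q. a \<le> q \<Longrightarrow> \<bar>w q\<bar> \<le> R"
    and drift: "\<And>y. y \<le> - l \<Longrightarrow> r * tanh (r * y + c) \<le> - \<rho>"
    and start: "Y q1 \<le> - (\<eta> * q1)"
    and large: "0 \<le> min \<eta> \<rho> - 2 * R" "l < (min \<eta> \<rho> - 2 * R) * q1"
  shows "Y q \<le> - (\<eta> * q1 + \<rho> * (q - q1) - 2 * R * q)"
proof -
  have "\<rho> \<le> r * tanh (r * y + - c)" if "l \<le> y" for y
    using drift[of "- y"] that tanh_minus[of "r * y + - c"] by simp
  then show ?thesis
    using drift_path_stays_above[OF drift_path_minus[OF path] q, of R l \<rho> \<eta>] w start large by simp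
qed

text \<open>Markov's inequality in pointwise form: where the noise bound \<open>R\<close> exceeds
  \<open>\<delta>\<close>, a loss \<open>K\<close> is charged to \<open>K / \<delta> * R\<close>,
  whose mean is small.\<close>

lemma le_scaled_excess:
  fixes K R \<delta> :: real
  assumes "0 < \<delta>" "\<delta> < R" "0 \<le> K"
  shows "K \<le> K / \<delta> * R"
proof -
  have "K * 1 \<le> K * (R / \<delta>)" using assms by (intro mult_left_mono) auto
  then show ?thesis by simp
qed

lemma tanh_threshold:
  fixes r \<rho> c :: real
  assumes "0 < r" "\<rho> < r"
  obtains l where "0 \<le> l" "\<And>y. l \<le> y \<Longrightarrow> \<rho> \<le> r * tanh (r * y + c)"
    "\<And>y. y \<le> - l \<Longrightarrow> r * tanh (r * y + c) \<le> - \<rho>"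
proof -
  have "eventually (\<lambda>x. \<rho> / r < tanh x) at_top"
    using assms by (intro order_tendstoD(1)[OF tanh_real_at_top]) simp
  then obtain N where N: "\<And>x. N \<le> x \<Longrightarrow> \<rho> / r < tanh x" by (auto simp: eventually_at_top_linorder)
  \<comment> \<open>Dividing by \<open>r\<close> turns a level for r y + c into a level for y, and
    the absolute values let the same \<open>l\<close> serve both signs of y.\<close>
  define l where "l = (\<bar>N\<bar> + \<bar>c\<bar>) / r"
  have l: "\<bar>N\<bar> + \<bar>c\<bar> \<le> r * y" if "l \<le> y" for y
    using that assms by (simp add: l_def field_simps)
  have up: "\<rho> \<le> r * tanh (r * y + c')" if "l \<le> y" "\<bar>c'\<bar> = \<bar>c\<bar>" for y c'
  proof -
    have "N \<le> r * y + c'" using l[OF that(1)] that(2) by linarith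
    then show ?thesis using N[of "r * y + c'"] assms by (simp add: field_simps)
  qed
  show thesis
  proof (rule that[of l])
    show "0 \<le> l" using assms by (simp add: l_def)
    show "\<rho> \<le> r * tanh (r * y + c)" if "l \<le> y" for y using up[OF that] by simp
    show "r * tanh (r * y + c) \<le> - \<rho>" if "y \<le> - l" for y
    proof -
      have "\<rho> \<le> r * tanh (r * - y + - c)" using that by (intro up) auto
      moreover have "tanh (r * - y + - c) = - tanh (r * y + c)"
        using tanh_minus[of "r * y + c"] by simp
      ultimately show ?thesis by simp
    qed
  qed
qed

lemma tanh_real_lipschitz: "\<bar>tanh x - tanh y\<bar> \<le> \<bar>x - y\<bar>" for x y :: real
proof -
  have "norm (1 - tanh z ^ 2) \<le> 1" for z :: real
    using tanh_real_bounds[of z] by (simp add: abs_le_iff abs_square_le_1)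
  then have "norm (tanh x - tanh y) \<le> 1 * norm (x - y)"
    by (intro field_differentiable_bound[of UNIV]) (auto intro!: derivative_eq_intros)
  then show ?thesis by simp
qed

section \<open>Euler approximation of a single path\<close>

fun euler_scheme :: "(real \<Rightarrow> real) \<Rightarrow> real \<Rightarrow> real \<Rightarrow> (nat \<Rightarrow> real) \<Rightarrow> nat \<Rightarrow> real" where
  "euler_scheme g d y \<xi> 0 = y"
| "euler_scheme g d y \<xi> (Suc k) = euler_scheme g d y \<xi> k + d * g (euler_scheme g d y \<xi> k) + \<xi> k"

text \<open>A discrete Gronwall estimate. Each step multiplies the old error by at most
  \<open>1 + d * r\<^sup>2\<close>, because the drift is Lipschitz with constant
  \<open>r\<^sup>2\<close>, and adds at most \<open>d * \<kappa>\<close>, where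
  \<open>\<kappa>\<close> bounds the oscillation of \<open>Y\<close> and \<open>w\<close> over one
  step. The weight of the noise increment in \<open>\<xi>\<close> stands for the integral of q dw;
  for Brownian noise it gives the increment variance exactly \<open>d\<close>.\<close>

lemma euler_scheme_error:
  fixes n k :: nat and a d :: real
  assumes path: "drift_path r c a w Y" and "0 < a" "0 < d"
    and osc: "\<And>x x'. x \<in> {a..a + n * d} \<Longrightarrow> x' \<in> {a..a + n * d} \<Longrightarrow> \<bar>x - x'\<bar> \<le> d \<Longrightarrow>
      2 * (r\<^sup>2 * \<bar>Y x - Y x'\<bar>) + 2 * \<bar>w x - w x'\<bar> \<le> \<kappa>"
    and \<xi>: "\<And>k. \<xi> k = sqrt ((a + k * d) * (a + Suc k * d)) * (w (a + Suc k * d) - w (a + k * d))"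
    and "k \<le> n"
  shows "\<bar>Y (a + k * d) - euler_scheme (\<lambda>y. r * tanh (r * y + c)) d (Y a) \<xi> k\<bar> \<le> k * d * \<kappa> * (1 + d * r\<^sup>2) ^ k"
  using \<open>k \<le> n\<close>
proof (induction k)
  case 0
  then show ?case by simp
next
  case (Suc k)
  define g where "g y = r * tanh (r * y + c)" for y
  have lip: "\<bar>g y - g y'\<bar> \<le> r\<^sup>2 * \<bar>y - y'\<bar>" for y y'
  proof -
    have "\<bar>g y - g y'\<bar> = \<bar>r\<bar> * \<bar>tanh (r * y + c) - tanh (r * y' + c)\<bar>"
      by (simp add: g_def flip: right_diff_distrib abs_mult)
    also have "\<dots> \<le> \<bar>r\<bar> * \<bar>(r * y + c) - (r * y' + c)\<bar>"
      by (intro mult_left_mono tanh_real_lipschitz) simp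
    also have "\<dots> = r\<^sup>2 * \<bar>y - y'\<bar>"
      by (simp add: power2_eq_square abs_mult flip: right_diff_distrib)
    finally show ?thesis .
  qed
  have \<kappa>: "0 \<le> \<kappa>" using osc[of a a] assms by simp
  define q q' where "q = a + k * d" and "q' = a + Suc k * d"
  have q: "a \<le> q" "0 < q" "q < q'" "q' - q = d" "q' \<le> a + n * d"
  proof -
    have "real (Suc k) * d \<le> n * d" using Suc.prems \<open>0 < d\<close> by (intro mult_right_mono) auto
    then show "a \<le> q" "0 < q" "q < q'" "q' - q = d" "q' \<le> a + n * d"
      using \<open>0 < a\<close> \<open>0 < d\<close> by (auto simp: q_def q'_def distrib_right add_pos_nonneg)
  qed
  define e where "e = euler_scheme g d (Y a) \<xi> k"
  obtain x where x: "x \<in> {q<..<q'}" and Y: "Y q' - Y q = q' * w q' - q * w q + (q' - q) * (g (Y x) - w x)"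
    using drift_path_increment[OF path q(1,3)] unfolding g_def by metis
  \<comment> \<open>The geometric mean lies between \<open>q\<close> and \<open>q'\<close>, so using
    it in place of \<open>q'\<close> costs at most \<open>d\<close> times an increment of
    \<open>w\<close>.\<close>
  define \<sigma> where "\<sigma> = sqrt (q * q')"
  have "sqrt (q * q) \<le> \<sigma>" "\<sigma> \<le> sqrt (q' * q')"
    unfolding \<sigma>_def using q by (intro real_sqrt_le_mono mult_mono; simp)+
  then have \<sigma>: "0 \<le> q' - \<sigma>" "q' - \<sigma> \<le> d" using q by auto
  \<comment> \<open>Five sources of error: the old error, the variation of the drift along the step,
    the drift taken at the approximate position, and two oscillations of the noise.\<close>
  have eq: "Y q' - (e + d * g e + \<xi> k)
      = (Y q - e) + d * (g (Y x) - g (Y q)) + d * (g (Y q) - g e) + d * (w q - w x) + (q' - \<sigma>) * (w q' - w q)"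
  proof -
    have "\<xi> k = \<sigma> * (w q' - w q)" using \<xi>[of k] by (simp add: \<sigma>_def q_def q'_def)
    moreover have "Y q' = Y q + q' * w q' - q * w q + d * (g (Y x) - w x)" using Y q by simp
    moreover have "q' * w q = q * w q + d * w q" unfolding q(4)[symmetric] by (simp add: algebra_simps)
    ultimately show ?thesis by (simp add: algebra_simps)
  qed
  have "\<bar>Y q' - (e + d * g e + \<xi> k)\<bar> \<le> \<bar>Y q - e\<bar> + d * \<bar>g (Y x) - g (Y q)\<bar> + d * \<bar>g (Y q) - g e\<bar> + d * \<bar>w q - w x\<bar> + d * \<bar>w q' - w q\<bar>"
  proof -
    have abs5: "\<bar>t1 + t2 + t3 + t4 + t5\<bar> \<le> a1 + a2 + a3 + a4 + a5"
      if "\<bar>t1\<bar> \<le> a1" "\<bar>t2\<bar> \<le> a2" "\<bar>t3\<bar> \<le> a3" "\<bar>t4\<bar> \<le> a4" "\<bar>t5\<bar> \<le> a5"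
      for t1 t2 t3 t4 t5 a1 a2 a3 a4 a5 :: real using that by linarith
    show ?thesis
      unfolding eq by (rule abs5) (use \<sigma> \<open>0 < d\<close> in \<open>simp_all add: abs_mult mult_right_mono\<close>)
  qed
  also have "\<dots> \<le> \<bar>Y q - e\<bar> * (1 + d * r\<^sup>2) + d * \<kappa>"
  proof -
    have "2 * (r\<^sup>2 * \<bar>Y x - Y q\<bar>) + 2 * \<bar>w x - w q\<bar> \<le> \<kappa>" "2 * (r\<^sup>2 * \<bar>Y q' - Y q\<bar>) + 2 * \<bar>w q' - w q\<bar> \<le> \<kappa>"
      using x q by (intro osc; auto)+
    moreover have aux: "u + v + v' \<le> \<kappa>"
      if "2 * A + 2 * v \<le> \<kappa>" "2 * B + 2 * v' \<le> \<kappa>" "u \<le> A" "0 \<le> B" for u v v' A B :: real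
      using that by linarith
    ultimately have "\<bar>g (Y x) - g (Y q)\<bar> + \<bar>w q - w x\<bar> + \<bar>w q' - w q\<bar> \<le> \<kappa>"
      unfolding abs_minus_commute[of "w q" "w x"] by (intro aux[OF _ _ lip]) auto
    then have "d * (\<bar>g (Y x) - g (Y q)\<bar> + \<bar>w q - w x\<bar> + \<bar>w q' - w q\<bar>) \<le> d * \<kappa>"
      using \<open>0 < d\<close> by (intro mult_left_mono) auto
    moreover have "d * \<bar>g (Y q) - g e\<bar> \<le> d * (r\<^sup>2 * \<bar>Y q - e\<bar>)"
      using \<open>0 < d\<close> by (intro mult_left_mono lip) auto
    ultimately show ?thesis by (simp add: algebra_simps)
  qed
  also have "\<dots> \<le> k * d * \<kappa> * (1 + d * r\<^sup>2) ^ k * (1 + d * r\<^sup>2) + d * \<kappa> * (1 + d * r\<^sup>2) ^ Suc k"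
  proof (rule add_mono)
    show "\<bar>Y q - e\<bar> * (1 + d * r\<^sup>2) \<le> k * d * \<kappa> * (1 + d * r\<^sup>2) ^ k * (1 + d * r\<^sup>2)"
      using Suc \<open>0 < d\<close> by (intro mult_right_mono) (auto simp: q_def e_def g_def[abs_def])
    have "d * \<kappa> * 1 \<le> d * \<kappa> * (1 + d * r\<^sup>2) ^ Suc k"
      using \<open>0 < d\<close> \<kappa> by (intro mult_left_mono one_le_power) auto
    then show "d * \<kappa> \<le> d * \<kappa> * (1 + d * r\<^sup>2) ^ Suc k" by simp
  qed
  also have "\<dots> = Suc k * d * \<kappa> * (1 + d * r\<^sup>2) ^ Suc k" by (simp add: algebra_simps)
  finally show ?case by (simp add: q'_def e_def g_def[abs_def])
qed

lemma euler_scheme_tendsto: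
  fixes a L :: real and \<xi> :: "nat \<Rightarrow> nat \<Rightarrow> real"
  assumes path: "drift_path r c a w Y" and "0 < a" "0 < L"
    and \<xi>: "\<And>n k. \<xi> n k = sqrt ((a + k * (L / n)) * (a + Suc k * (L / n))) *
      (w (a + Suc k * (L / n)) - w (a + k * (L / n)))"
  shows "(\<lambda>n. euler_scheme (\<lambda>y. r * tanh (r * y + c)) (L / n) (Y a) (\<xi> n) n) \<longlonglongrightarrow> Y (a + L)"
proof (rule LIMSEQ_I)
  fix \<epsilon> :: real assume "0 < \<epsilon>"
  \<comment> \<open>Chosen so that the total error \<open>L * \<kappa> * exp (L * r\<^sup>2)\<close>
    equals half of \<open>\<epsilon>\<close>.\<close>
  define \<kappa> where "\<kappa> = \<epsilon> / (2 * L * exp (L * r\<^sup>2))"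
  have "0 < \<kappa>" using \<open>0 < \<epsilon>\<close> \<open>0 < L\<close> by (simp add: \<kappa>_def)
  \<comment> \<open>One modulus of continuity for the pair controls both oscillations, with the
    coefficients that \<open>euler_scheme_error\<close> asks for.\<close>
  define f where "f x = (2 * r\<^sup>2 * Y x, 2 * w x)" for x
  have "continuous_on {a..a + L} f"
    using path unfolding f_def drift_path_def
    by (intro continuous_intros) (auto elim: continuous_on_subset)
  then have "uniformly_continuous_on {a..a + L} f"
    by (intro compact_uniformly_continuous) auto
  then obtain \<delta> where "0 < \<delta>"
    and \<delta>: "\<And>x x'. x \<in> {a..a + L} \<Longrightarrow> x' \<in> {a..a + L} \<Longrightarrow> \<bar>x - x'\<bar> < \<delta> \<Longrightarrow> dist (f x) (f x') < \<kappa> / 2"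
    unfolding uniformly_continuous_on_def dist_real_def using \<open>0 < \<kappa>\<close>
    by (metis abs_minus_commute half_gt_zero)
  obtain N :: nat where N: "L / \<delta> < N" using reals_Archimedean2 by blast
  show "\<exists>no. \<forall>n\<ge>no. norm (euler_scheme (\<lambda>y. r * tanh (r * y + c)) (L / n) (Y a) (\<xi> n) n - Y (a + L)) < \<epsilon>"
  proof (intro exI allI impI)
    fix n assume "Suc N \<le> n"
    then have n: "0 < n" "L / \<delta> < n" using N by linarith+
    define d where "d = L / n"
    have d: "0 < d" "d < \<delta>" "n * d = L"
      using n \<open>0 < L\<close> \<open>0 < \<delta>\<close> by (auto simp: d_def field_simps)
    have "\<bar>Y (a + n * d) - euler_scheme (\<lambda>y. r * tanh (r * y + c)) d (Y a) (\<xi> n) n\<bar> \<le> n * d * \<kappa> * (1 + d * r\<^sup>2) ^ n"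
    proof (rule euler_scheme_error[OF path \<open>0 < a\<close> d(1)])
      fix x x' assume x: "x \<in> {a..a + n * d}" "x' \<in> {a..a + n * d}" "\<bar>x - x'\<bar> \<le> d"
      then have *: "dist (f x) (f x') < \<kappa> / 2" using d by (intro \<delta>) auto
      have "dist (2 * r\<^sup>2 * Y x) (2 * r\<^sup>2 * Y x') < \<kappa> / 2" "dist (2 * w x) (2 * w x') < \<kappa> / 2"
        using le_less_trans[OF dist_fst_le *] le_less_trans[OF dist_snd_le *] by (auto simp: f_def)
      then show "2 * (r\<^sup>2 * \<bar>Y x - Y x'\<bar>) + 2 * \<bar>w x - w x'\<bar> \<le> \<kappa>"
        unfolding dist_real_def right_diff_distrib[symmetric] abs_mult by simp
    next
      show "\<xi> n k = sqrt ((a + k * d) * (a + Suc k * d)) * (w (a + Suc k * d) - w (a + k * d))" for k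
        unfolding \<xi> d_def ..
    qed simp
    also have "\<dots> \<le> L * \<kappa> * exp (L * r\<^sup>2)"
    proof -
      have "(1 + d * r\<^sup>2) ^ n \<le> exp (d * r\<^sup>2) ^ n"
        using d by (intro power_mono exp_ge_add_one_self) auto
      also have "\<dots> = exp (L * r\<^sup>2)" unfolding exp_of_nat_mult[symmetric] mult.assoc[symmetric] d(3) ..
      finally show ?thesis using d \<open>0 < L\<close> \<open>0 < \<kappa>\<close> by (intro mult_mono) auto
    qed
    also have "\<dots> = \<epsilon> / 2" using \<open>0 < L\<close> by (simp add: \<kappa>_def)
    finally show "norm (euler_scheme (\<lambda>y. r * tanh (r * y + c)) (L / n) (Y a) (\<xi> n) n - Y (a + L)) < \<epsilon>"
      using \<open>0 < \<epsilon>\<close> d by (simp add: d_def abs_minus_commute)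
  qed
qed

section \<open>Expectations along the Euler scheme\<close>

text \<open>Order three suffices: a Gaussian step of variance d has a third absolute moment of order
  d^(3/2), so that L / d steps together contribute O(sqrt d).\<close>

lemma taylor3:
  fixes \<phi> :: "real \<Rightarrow> real"
  assumes der: "\<And>x. (\<phi> has_real_derivative \<phi>1 x) (at x)" "\<And>x. (\<phi>1 has_real_derivative \<phi>2 x) (at x)"
    "\<And>x. (\<phi>2 has_real_derivative \<phi>3 x) (at x)" and K: "\<And>x. \<bar>\<phi>3 x\<bar> \<le> K"
  shows "\<bar>\<phi> (y + h) - (\<phi> y + \<phi>1 y * h + \<phi>2 y / 2 * h\<^sup>2)\<bar> \<le> K / 6 * \<bar>h\<bar> ^ 3"
proof -
  define diff where "diff m t = ([\<phi>, \<phi>1, \<phi>2, \<phi>3] ! m) (y + t)" for m :: nat and t :: real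
  have "\<exists>t. \<bar>t\<bar> \<le> \<bar>h\<bar> \<and> \<phi> (y + h) = (\<Sum>m<3. diff m 0 / fact m * h ^ m) + diff 3 t / fact 3 * h ^ 3"
  proof (rule Maclaurin_bi_le)
    show "diff 0 = (\<lambda>h. \<phi> (y + h))" by (simp add: diff_def[abs_def])
    have "DERIV (diff m) t :> diff (Suc m) t" if "m < 3" for m t
    proof -
      consider "m = 0" | "m = 1" | "m = 2" using \<open>m < 3\<close> by linarith
      then show ?thesis
        using der[of "y + t"] by cases (auto simp: diff_def[abs_def] DERIV_shift add.commute)
    qed
    then show "\<forall>m t. m < 3 \<and> \<bar>t\<bar> \<le> \<bar>h\<bar> \<longrightarrow> DERIV (diff m) t :> diff (Suc m) t" by blast
  qed
  then obtain t where "\<phi> (y + h) = (\<Sum>m<3. diff m 0 / fact m * h ^ m) + diff 3 t / fact 3 * h ^ 3"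
    by blast
  then have "\<phi> (y + h) = (\<phi> y + \<phi>1 y * h + \<phi>2 y / 2 * h\<^sup>2) + \<phi>3 (y + t) / 6 * h ^ 3"
    by (simp add: diff_def numeral_3_eq_3 lessThan_Suc fact_numeral power2_eq_square)
  then have "\<bar>\<phi> (y + h) - (\<phi> y + \<phi>1 y * h + \<phi>2 y / 2 * h\<^sup>2)\<bar> = \<bar>\<phi>3 (y + t)\<bar> / 6 * \<bar>h\<bar> ^ 3"
    by (simp add: abs_mult power_abs)
  also have "\<dots> \<le> K / 6 * \<bar>h\<bar> ^ 3"
    using K by (intro mult_right_mono divide_right_mono) auto
  finally show ?thesis .
qed

lemma cube_sum_bound:
  fixes a x :: real
  shows "\<bar>a + x\<bar> ^ 3 \<le> 4 * (\<bar>a\<bar> ^ 3 + \<bar>x\<bar> ^ 3)"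
proof -
  have "\<bar>a + x\<bar> ^ 3 \<le> (\<bar>a\<bar> + \<bar>x\<bar>) ^ 3" by (intro power_mono) auto
  \<comment> \<open>With u and v the absolute values of \<open>a\<close> and \<open>x\<close>, the
    added term is 4 (u^3 + v^3) - (u + v)^3 = 3 (u + v) (u - v)^2.\<close>
  also have "\<dots> \<le> (\<bar>a\<bar> + \<bar>x\<bar>) ^ 3 + 3 * ((\<bar>a\<bar> + \<bar>x\<bar>) * (\<bar>a\<bar> - \<bar>x\<bar>)\<^sup>2)" by simp
  also have "\<dots> = 4 * (\<bar>a\<bar> ^ 3 + \<bar>x\<bar> ^ 3)"
    by (simp add: power2_eq_square power3_eq_cube algebra_simps)
  finally show ?thesis .
qed

text \<open>Trades the third absolute moment for the second and fourth moments, which are explicit.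
  With \<open>s\<close> the standard deviation of a Gaussian, both terms have mean of order
  s^3.\<close>

lemma abs_cube_bound:
  fixes s x :: real
  assumes "0 < s"
  shows "\<bar>x\<bar> ^ 3 \<le> (s * x\<^sup>2 + x ^ 4 / s) / 2"
proof -
  define u where "u = \<bar>x\<bar>"
  have "0 \<le> u\<^sup>2 * (s - u)\<^sup>2 / s" using assms by simp
  also have "\<dots> = s * u\<^sup>2 + u ^ 4 / s - 2 * u ^ 3"
    using assms by (simp add: field_simps power2_eq_square power3_eq_cube power4_eq_xxxx)
  finally show ?thesis by (simp add: u_def)
qed

text \<open>Taylor expansion at \<open>y\<close>: the increment d g + X has mean d g and second
  moment d up to order d^2, so the mean of \<open>\<phi>\<close> changes by d times the generator,
  that is by - \<open>\<mu> * d * \<phi> y\<close>. In the constant, K^3 / 2 pays for the square of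
  d g and the other summand for the cubic remainder.\<close>

lemma (in prob_space) gaussian_step:
  fixes \<phi> :: "real \<Rightarrow> real"
  assumes X: "distributed M lborel X (normal_density 0 (sqrt d))" and d: "0 < d" "d \<le> 1"
    and der: "\<And>x. (\<phi> has_real_derivative \<phi>1 x) (at x)" "\<And>x. (\<phi>1 has_real_derivative \<phi>2 x) (at x)"
      "\<And>x. (\<phi>2 has_real_derivative \<phi>3 x) (at x)"
    and K: "\<And>x. \<bar>\<phi> x\<bar> \<le> K" "\<And>x. \<bar>\<phi>2 x\<bar> \<le> K" "\<And>x. \<bar>\<phi>3 x\<bar> \<le> K" "\<bar>g\<bar> \<le> K"
    and generator: "\<phi>1 y * g + \<phi>2 y / 2 = - \<mu> * \<phi> y"
  shows "\<bar>expectation (\<lambda>\<omega>. \<phi> (y + d * g + X \<omega>)) - (1 - \<mu> * d) * \<phi> y\<bar>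
    \<le> (K ^ 3 / 2 + 2 * K / 3 * (K ^ 3 + 2)) * (d * sqrt d)"
proof -
  define s where "s = sqrt d"
  have s: "0 < s" "s \<le> 1" "s\<^sup>2 = d" "s ^ 4 = d\<^sup>2" using d by (auto simp: s_def real_sqrt_power_even)
  note moments = centered_normal_moments[OF X[folded s_def] s(1)]
  have intX: "integrable M (\<lambda>\<omega>. X \<omega> ^ k)" for k by (rule moments(1))
  have intX1: "integrable M X" using intX[of 1] by simp
  have Xm[measurable]: "X \<in> borel_measurable M" using intX1 by auto
  have K0: "0 \<le> K" using K(1)[of 0] by simp
  have ds: "d\<^sup>2 \<le> d * s" "d ^ 3 \<le> d * s"
  proof -
    have "d * 1 \<le> s * 1" using s by (simp flip: s(3) add: power2_eq_square mult_left_le)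
    then have *: "d * d \<le> d * s" using d by (intro mult_left_mono) auto
    then show "d\<^sup>2 \<le> d * s" by (simp add: power2_eq_square)
    have "d * d * d \<le> d * d * 1" using d by (intro mult_left_mono) auto
    then show "d ^ 3 \<le> d * s" using * by (simp add: power3_eq_cube)
  qed
  have contphi: "continuous_on UNIV \<phi>"
    using der(1) by (meson DERIV_isCont continuous_at_imp_continuous_on)
  have \<phi>m[measurable]: "\<phi> \<in> borel_measurable borel"
    using contphi by (rule borel_measurable_continuous_onI)
  define A where "A = d * g"
  define P where "P x = \<phi> y + \<phi>1 y * A + \<phi>2 y / 2 * A\<^sup>2 + (\<phi>1 y + \<phi>2 y * A) * x + \<phi>2 y / 2 * x\<^sup>2" for x
  define B where "B x = 2 * K / 3 * (d * s * K ^ 3 + (s * x\<^sup>2 + x ^ 4 / s) / 2)" for x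
  have rem: "\<bar>\<phi> (y + A + x) - P x\<bar> \<le> B x" for x
  proof -
    have "P x = \<phi> y + \<phi>1 y * (A + x) + \<phi>2 y / 2 * (A + x)\<^sup>2"
      by (simp add: P_def power2_eq_square algebra_simps add_divide_distrib)
    then have "\<bar>\<phi> (y + A + x) - P x\<bar> \<le> K / 6 * \<bar>A + x\<bar> ^ 3"
      using taylor3[of \<phi> \<phi>1 \<phi>2 \<phi>3 K y "A + x", OF der K(3)] by (simp add: add.assoc)
    also have "\<dots> \<le> K / 6 * (4 * (d * s * K ^ 3 + (s * x\<^sup>2 + x ^ 4 / s) / 2))"
    proof (intro mult_left_mono)
      have "\<bar>A\<bar> ^ 3 = d ^ 3 * \<bar>g\<bar> ^ 3" using d by (simp add: A_def abs_mult power_mult_distrib)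
      also have "\<dots> \<le> (d * s) * K ^ 3" using ds K(4) d s by (intro mult_mono power_mono) auto
      finally show "\<bar>A + x\<bar> ^ 3 \<le> 4 * (d * s * K ^ 3 + (s * x\<^sup>2 + x ^ 4 / s) / 2)"
        using abs_cube_bound[OF s(1), of x]
        by (intro order_trans[OF cube_sum_bound] mult_left_mono add_mono) simp_all
    qed (use K0 in auto)
    also have "K / 6 * (4 * D) = 2 * K / 3 * D" for D by simp
    finally show ?thesis by (simp only: B_def)
  qed
  have intP: "integrable M (\<lambda>\<omega>. P (X \<omega>))"
    unfolding P_def using intX[of 2] intX1 by (intro Bochner_Integration.integrable_add integrable_mult_right) auto
  have intB: "integrable M (\<lambda>\<omega>. B (X \<omega>))"
    unfolding B_def using intX[of 2] intX[of 4] by auto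
  have int\<phi>: "integrable M (\<lambda>\<omega>. \<phi> (y + A + X \<omega>))"
    by (rule integrable_const_bound[of _ K]) (use K in auto)
  have EP: "expectation (\<lambda>\<omega>. P (X \<omega>)) = (1 - \<mu> * d) * \<phi> y + \<phi>2 y / 2 * A\<^sup>2"
  proof -
    have "expectation (\<lambda>\<omega>. P (X \<omega>)) = \<phi> y + \<phi>1 y * A + \<phi>2 y / 2 * A\<^sup>2 + \<phi>2 y / 2 * d"
      unfolding P_def using intX[of 2] intX1 moments(2,3) s(3) by (simp add: prob_space)
    also have "\<dots> = \<phi> y + d * (\<phi>1 y * g + \<phi>2 y / 2) + \<phi>2 y / 2 * A\<^sup>2"
      by (simp add: A_def algebra_simps)
    also have "\<dots> = (1 - \<mu> * d) * \<phi> y + \<phi>2 y / 2 * A\<^sup>2"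
      unfolding generator by (simp add: algebra_simps)
    finally show ?thesis .
  qed
  have EB: "expectation (\<lambda>\<omega>. B (X \<omega>)) = 2 * K / 3 * (K ^ 3 + 2) * (d * s)"
  proof -
    have "expectation (\<lambda>\<omega>. B (X \<omega>)) = 2 * K / 3 * (d * s * K ^ 3 + (s * d + 3 * d\<^sup>2 / s) / 2)"
      unfolding B_def using intX[of 2] intX[of 4] moments(3,4) s by (simp add: prob_space)
    also have "d\<^sup>2 / s = d * s" using s by (simp flip: s(3) add: power2_eq_square)
    then have "3 * d\<^sup>2 / s = 3 * (d * s)" by simp
    finally show ?thesis by (simp add: algebra_simps)
  qed
  have "\<bar>expectation (\<lambda>\<omega>. \<phi> (y + A + X \<omega>)) - expectation (\<lambda>\<omega>. P (X \<omega>))\<bar>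
      = \<bar>expectation (\<lambda>\<omega>. \<phi> (y + A + X \<omega>) - P (X \<omega>))\<bar>"
    using int\<phi> intP by simp
  also have "\<dots> \<le> expectation (\<lambda>\<omega>. \<bar>\<phi> (y + A + X \<omega>) - P (X \<omega>)\<bar>)" by (rule integral_abs_bound)
  also have "\<dots> \<le> expectation (\<lambda>\<omega>. B (X \<omega>))"
    using int\<phi> intP intB rem by (intro integral_mono) auto
  finally have 1: "\<bar>expectation (\<lambda>\<omega>. \<phi> (y + A + X \<omega>)) - expectation (\<lambda>\<omega>. P (X \<omega>))\<bar>
      \<le> 2 * K / 3 * (K ^ 3 + 2) * (d * s)" unfolding EB .
  have 2: "\<bar>\<phi>2 y / 2 * A\<^sup>2\<bar> \<le> K ^ 3 / 2 * (d * s)"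
  proof -
    have "\<bar>\<phi>2 y / 2 * A\<^sup>2\<bar> = \<bar>\<phi>2 y\<bar> * \<bar>g\<bar>\<^sup>2 * d\<^sup>2 / 2"
      by (simp add: A_def abs_mult power_mult_distrib)
    also have "\<dots> \<le> K * K\<^sup>2 * (d * s) / 2"
      using K ds K0 d s by (intro divide_right_mono mult_mono power_mono) auto
    finally show ?thesis by (simp add: power2_eq_square power3_eq_cube)
  qed
  have "\<bar>expectation (\<lambda>\<omega>. \<phi> (y + A + X \<omega>)) - (1 - \<mu> * d) * \<phi> y\<bar>
      \<le> 2 * K / 3 * (K ^ 3 + 2) * (d * s) + K ^ 3 / 2 * (d * s)"
    using 1 2 EP by linarith
  then show ?thesis by (simp add: A_def s_def algebra_simps)
qed

text \<open>Fubini for the joint law, which is a product: freezing \<open>Y\<close> and averaging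
  over \<open>X\<close> takes the place of conditioning on \<open>Y\<close>.\<close>

lemma (in prob_space) indep_var_expectation:
  fixes f :: "real \<times> real \<Rightarrow> real"
  assumes ind: "indep_var borel Y borel X" and f[measurable]: "f \<in> borel_measurable borel" and K: "\<And>x. \<bar>f x\<bar> \<le> K"
  shows "integrable M (\<lambda>\<omega>. expectation (\<lambda>\<omega>'. f (Y \<omega>, X \<omega>')))"
    and "expectation (\<lambda>\<omega>. f (Y \<omega>, X \<omega>)) = expectation (\<lambda>\<omega>. expectation (\<lambda>\<omega>'. f (Y \<omega>, X \<omega>')))"
proof -
  have Y[measurable]: "Y \<in> borel_measurable M" and X[measurable]: "X \<in> borel_measurable M"
    and eq: "distr M borel Y \<Otimes>\<^sub>M distr M borel X = distr M (borel \<Otimes>\<^sub>M borel) (\<lambda>x. (Y x, X x))"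
    using ind unfolding indep_var_distribution_eq by auto
  interpret PY: prob_space "distr M borel Y" by (rule prob_space_distr) simp
  interpret PX: prob_space "distr M borel X" by (rule prob_space_distr) simp
  interpret P: pair_prob_space "distr M borel Y" "distr M borel X" ..
  have fm[measurable]: "f \<in> borel_measurable (borel \<Otimes>\<^sub>M borel)" using f by (simp add: borel_prod)
  have intf: "integrable (distr M borel Y \<Otimes>\<^sub>M distr M borel X) f"
    by (rule P.integrable_const_bound[of _ K]) (auto simp: K cong: measurable_cong_sets)
  have inner: "(\<integral>x. f (y, x) \<partial>distr M borel X) = expectation (\<lambda>\<omega>'. f (y, X \<omega>'))" for y
    by (rule integral_distr) auto
  have m[measurable]: "(\<lambda>y. expectation (\<lambda>\<omega>'. f (y, X \<omega>'))) \<in> borel_measurable borel"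
  proof -
    have "(\<lambda>y. \<integral>x. f (y, x) \<partial>distr M borel X) \<in> borel_measurable borel"
      by (rule PX.borel_measurable_lebesgue_integral) (simp cong: measurable_cong_sets)
    then show ?thesis by (simp add: inner)
  qed
  have "0 \<le> K" using K[of "(0, 0)"] by linarith
  have "\<bar>expectation (\<lambda>\<omega>'. f (y, X \<omega>'))\<bar> \<le> K" for y
  proof -
    have "\<bar>expectation (\<lambda>\<omega>'. f (y, X \<omega>'))\<bar> \<le> expectation (\<lambda>\<omega>'. \<bar>f (y, X \<omega>')\<bar>)"
      by (rule integral_abs_bound)
    also have "\<dots> \<le> expectation (\<lambda>\<omega>'. K)"
      using K \<open>0 \<le> K\<close> by (intro integral_mono integrable_const_bound[of _ K]) auto
    finally show ?thesis by (simp add: prob_space)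
  qed
  then show "integrable M (\<lambda>\<omega>. expectation (\<lambda>\<omega>'. f (Y \<omega>, X \<omega>')))"
    by (intro integrable_const_bound[of _ K]) auto
  have "expectation (\<lambda>\<omega>. f (Y \<omega>, X \<omega>)) = (\<integral>z. f z \<partial>(distr M borel Y \<Otimes>\<^sub>M distr M borel X))"
    unfolding eq by (subst integral_distr) auto
  also have "\<dots> = (\<integral>y. (\<integral>x. f (y, x) \<partial>distr M borel X) \<partial>distr M borel Y)"
    by (rule P.integral_fst'[OF intf, symmetric])
  also have "\<dots> = expectation (\<lambda>\<omega>. expectation (\<lambda>\<omega>'. f (Y \<omega>, X \<omega>')))"
    unfolding inner by (rule integral_distr) auto
  finally show "expectation (\<lambda>\<omega>. f (Y \<omega>, X \<omega>)) = expectation (\<lambda>\<omega>. expectation (\<lambda>\<omega>'. f (Y \<omega>, X \<omega>')))" .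
qed

lemma euler_scheme_cong:
  "(\<And>i. i < k \<Longrightarrow> \<xi> i = \<xi>' i) \<Longrightarrow> euler_scheme g d y \<xi> k = euler_scheme g d y \<xi>' k"
  by (induction k) auto

lemma euler_scheme_measurable:
  assumes [measurable]: "g \<in> borel_measurable borel" "\<And>i. i < k \<Longrightarrow> (\<lambda>\<omega>. \<xi> \<omega> i) \<in> borel_measurable N"
  shows "(\<lambda>\<omega>. euler_scheme g d y (\<xi> \<omega>) k) \<in> borel_measurable N"
  using assms(2)
proof (induction k)
  case (Suc k)
  have [measurable]: "(\<lambda>\<omega>. euler_scheme g d y (\<xi> \<omega>) k) \<in> borel_measurable N"
    "(\<lambda>\<omega>. \<xi> \<omega> k) \<in> borel_measurable N"
    using Suc by auto
  show ?case by simp measurable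
qed simp

text \<open>After \<open>k\<close> steps the scheme is a function of the noise terms with index
  below \<open>k\<close>, a block independent of the term with index \<open>k\<close>.\<close>

lemma (in prob_space) euler_scheme_indep:
  assumes ind: "indep_vars (\<lambda>_. borel) \<xi> {..<n}" and "k < n" and g: "g \<in> borel_measurable borel"
  shows "indep_var borel (\<lambda>\<omega>. euler_scheme g d y (\<lambda>i. \<xi> i \<omega>) k) borel (\<xi> k)"
proof -
  have "indep_var (PiM {..<k} (\<lambda>_. borel)) (\<lambda>\<omega>. restrict (\<lambda>i. \<xi> i \<omega>) {..<k})
      (PiM {k} (\<lambda>_. borel)) (\<lambda>\<omega>. restrict (\<lambda>i. \<xi> i \<omega>) {k})"
    using \<open>k < n\<close> by (intro indep_var_restrict[OF ind]) auto
  then have "indep_var borel ((\<lambda>x. euler_scheme g d y x k) \<circ> (\<lambda>\<omega>. restrict (\<lambda>i. \<xi> i \<omega>) {..<k}))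
      borel ((\<lambda>x. x k) \<circ> (\<lambda>\<omega>. restrict (\<lambda>i. \<xi> i \<omega>) {k}))"
    by (rule indep_var_compose) (auto intro!: euler_scheme_measurable g)
  moreover have "((\<lambda>x. euler_scheme g d y x k) \<circ> (\<lambda>\<omega>. restrict (\<lambda>i. \<xi> i \<omega>) {..<k}))
      = (\<lambda>\<omega>. euler_scheme g d y (\<lambda>i. \<xi> i \<omega>) k)"
    by (auto simp: fun_eq_iff intro!: euler_scheme_cong)
  moreover have "((\<lambda>x. x k) \<circ> (\<lambda>\<omega>. restrict (\<lambda>i. \<xi> i \<omega>) {k})) = \<xi> k" by auto
  ultimately show ?thesis by simp
qed

text \<open>The one-step errors simply add up, since each step multiplies the inherited error by
  \<open>1 - \<mu> * d\<close>, a number in [0, 1]. When n = L / d the bound is O(sqrt d).\<close>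

lemma (in prob_space) euler_scheme_expectation:
  fixes \<phi> :: "real \<Rightarrow> real"
  assumes ind: "indep_vars (\<lambda>_. borel) \<xi> {..<n}"
    and \<xi>: "\<And>k. k < n \<Longrightarrow> distributed M lborel (\<xi> k) (normal_density 0 (sqrt d))"
    and d: "0 < d" "d \<le> 1" and \<mu>: "0 \<le> \<mu>" "\<mu> * d \<le> 1"
    and der: "\<And>x. (\<phi> has_real_derivative \<phi>1 x) (at x)" "\<And>x. (\<phi>1 has_real_derivative \<phi>2 x) (at x)"
      "\<And>x. (\<phi>2 has_real_derivative \<phi>3 x) (at x)"
    and K: "\<And>x. \<bar>\<phi> x\<bar> \<le> K" "\<And>x. \<bar>\<phi>2 x\<bar> \<le> K" "\<And>x. \<bar>\<phi>3 x\<bar> \<le> K" "\<And>x. \<bar>g x\<bar> \<le> K"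
    and g[measurable]: "g \<in> borel_measurable borel"
    and generator: "\<And>x. \<phi>1 x * g x + \<phi>2 x / 2 = - \<mu> * \<phi> x"
  shows "\<bar>expectation (\<lambda>\<omega>. \<phi> (euler_scheme g d y (\<lambda>i. \<xi> i \<omega>) n)) - (1 - \<mu> * d) ^ n * \<phi> y\<bar>
    \<le> n * ((K ^ 3 / 2 + 2 * K / 3 * (K ^ 3 + 2)) * (d * sqrt d))"
proof -
  define C where "C = (K ^ 3 / 2 + 2 * K / 3 * (K ^ 3 + 2)) * (d * sqrt d)"
  define \<theta> where "\<theta> = 1 - \<mu> * d"
  have \<theta>: "0 \<le> \<theta>" "\<theta> \<le> 1" using \<mu> d by (auto simp: \<theta>_def)
  have contphi: "continuous_on UNIV \<phi>"
    using der(1) by (meson DERIV_isCont continuous_at_imp_continuous_on)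
  have \<phi>m[measurable]: "\<phi> \<in> borel_measurable borel"
    using contphi by (rule borel_measurable_continuous_onI)
  have "\<bar>expectation (\<lambda>\<omega>. \<phi> (euler_scheme g d y (\<lambda>i. \<xi> i \<omega>) k)) - \<theta> ^ k * \<phi> y\<bar> \<le> k * C" if "k \<le> n" for k
    using that
  proof (induction k)
    case 0
    then show ?case by (simp add: prob_space)
  next
    case (Suc k)
    define Y where "Y \<omega> = euler_scheme g d y (\<lambda>i. \<xi> i \<omega>) k" for \<omega>
    have iv: "indep_var borel Y borel (\<xi> k)"
      unfolding Y_def[abs_def] using Suc.prems by (intro euler_scheme_indep[OF ind _ g]) simp
    have [measurable]: "Y \<in> borel_measurable M" using iv by (rule indep_var_rv1)
    define f where "f z = \<phi> (fst z + d * g (fst z) + snd z)" for z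
    have "f \<in> borel_measurable (borel \<Otimes>\<^sub>M borel)" unfolding f_def by measurable
    then have fm: "f \<in> borel_measurable borel" by (simp add: borel_prod)
    have fK: "\<bar>f z\<bar> \<le> K" for z by (simp add: f_def K)
    define \<Psi> where "\<Psi> \<omega> = expectation (\<lambda>\<omega>'. f (Y \<omega>, \<xi> k \<omega>'))" for \<omega>
    note \<Psi> = indep_var_expectation[OF iv fm fK, folded \<Psi>_def]
    have step: "\<bar>\<Psi> \<omega> - \<theta> * \<phi> (Y \<omega>)\<bar> \<le> C" for \<omega>
      unfolding \<Psi>_def f_def C_def \<theta>_def fst_conv snd_conv using Suc.prems
      by (intro gaussian_step[OF \<xi> d der K generator]) simp
    have int: "integrable M (\<lambda>\<omega>. \<phi> (Y \<omega>))"
      by (rule integrable_const_bound[of _ K]) (auto simp: K)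
    have "\<bar>expectation \<Psi> - \<theta> * expectation (\<lambda>\<omega>. \<phi> (Y \<omega>))\<bar> = \<bar>expectation (\<lambda>\<omega>. \<Psi> \<omega> - \<theta> * \<phi> (Y \<omega>))\<bar>"
      using int \<Psi>(1) by simp
    also have "\<dots> \<le> expectation (\<lambda>\<omega>. \<bar>\<Psi> \<omega> - \<theta> * \<phi> (Y \<omega>)\<bar>)" by (rule integral_abs_bound)
    also have "\<dots> \<le> expectation (\<lambda>\<omega>. C)"
      using int \<Psi>(1) step by (intro integral_mono) auto
    also have "\<dots> = C" by (simp add: prob_space)
    finally have 1: "\<bar>expectation \<Psi> - \<theta> * expectation (\<lambda>\<omega>. \<phi> (Y \<omega>))\<bar> \<le> C" .
    have "\<bar>expectation (\<lambda>\<omega>. \<phi> (Y \<omega>)) - \<theta> ^ k * \<phi> y\<bar> \<le> k * C"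
      using Suc unfolding Y_def by simp
    then have "\<theta> * \<bar>expectation (\<lambda>\<omega>. \<phi> (Y \<omega>)) - \<theta> ^ k * \<phi> y\<bar> \<le> 1 * (k * C)"
      using \<theta> by (intro mult_mono) auto
    then have 2: "\<bar>\<theta> * expectation (\<lambda>\<omega>. \<phi> (Y \<omega>)) - \<theta> ^ Suc k * \<phi> y\<bar> \<le> k * C"
      using \<theta> by (simp add: abs_mult_pos' right_diff_distrib mult.assoc)
    have "expectation (\<lambda>\<omega>. \<phi> (euler_scheme g d y (\<lambda>i. \<xi> i \<omega>) (Suc k))) = expectation \<Psi>"
      using \<Psi>(2) by (simp add: f_def Y_def)
    then show ?case using 1 2 by (simp add: algebra_simps)
  qed
  then show ?thesis unfolding C_def \<theta>_def by blast
qed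

section \<open>The pinned process in the inverse clock\<close>

text \<open>For p in (0, 1) its tanh is 2 p - 1, the prior mean divided by r. The posterior log odds
  are twice the sum of \<open>r * (z / (1 - t))\<close> and this number, hence the half.\<close>

definition half_log_odds :: "real \<Rightarrow> real" where
  "half_log_odds p = ln (p / (1 - p)) / 2"

text \<open>The posterior probability is the logistic function at 2 x, and twice that minus 1 is
  tanh x.\<close>

lemma posterior_mean_eq_tanh:
  assumes "0 < p" "p < 1"
  shows "posterior_mean r p t z = r * tanh (r * (z / (1 - t)) + half_log_odds p)"
proof -
  define x where "x = r * (z / (1 - t)) + half_log_odds p"
  have "exp (2 * x) = p / (1 - p) * exp (2 * r * z / (1 - t))"
    using assms by (simp add: x_def half_log_odds_def exp_add distrib_left mult.assoc mult.commute)
  then have "posterior_mean r p t z = r * (2 * (exp (2 * x) / (exp (2 * x) + 1)) - 1)"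
    by (simp add: posterior_mean_def posterior_prob_def)
  also have "2 * (exp (2 * x) / (exp (2 * x) + 1)) - 1 = (exp (2 * x) - 1) / (exp (2 * x) + 1)"
  proof -
    have "2 * (E / (E + 1)) - 1 = (E - 1) / (E + 1)" if "0 < E" for E :: real
      using that by (simp add: field_simps)
    then show ?thesis by simp
  qed
  also have "\<dots> = tanh x"
  proof -
    have "(E - 1) / (E + 1) = (1 - 1 / E) / (1 + 1 / E)" if "0 < E" for E :: real
    proof -
      have "0 < 1 + 1 / E" using that by (simp add: add_pos_pos)
      then show ?thesis using that by (subst frac_eq_eq) (auto simp: field_simps)
    qed
    from this[of "exp (2 * x)"] show ?thesis
      by (simp add: tanh_real_altdef exp_minus inverse_eq_divide)
  qed
  finally show ?thesis by (simp add: x_def)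
qed

text \<open>By the product rule, q (z + I) has derivative z + I plus q b / q^2. The first part is Z
  - W; the second is the posterior mean minus Z, because the remaining time is 1 / q. The two copies
  of Z cancel, and by \<open>posterior_mean_eq_tanh\<close> the remaining drift depends on q only
  through Y.\<close>

lemma drift_path_time_change:
  fixes Z W :: "real \<Rightarrow> real"
  assumes t: "t < 1" and p: "0 < p" "p < 1"
    and Z: "continuous_on {t..<1} Z" and W: "continuous_on {0..} W"
    and eq: "\<And>s. 0 \<le> s \<Longrightarrow> s < 1 - t \<Longrightarrow> Z (t + s) = z + integral {0..s}
                (\<lambda>u. (posterior_mean r p (t + u) (Z (t + u)) - Z (t + u)) / (1 - (t + u))) + W s"
  shows "drift_path r (half_log_odds p) (1 / (1 - t)) (\<lambda>q. W (1 - t - 1 / q)) (\<lambda>q. q * Z (1 - 1 / q))"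
proof -
  define a where "a = 1 / (1 - t)"
  have a: "0 < a" "1 / a = 1 - t" using t by (auto simp: a_def)
  define S where "S q = 1 - t - 1 / q" for q :: real
  have inv: "1 / q \<le> 1 / a" if "a \<le> q" for q using that a by (intro divide_left_mono) auto
  have S: "0 \<le> S q" "S q < 1 - t" "1 - 1 / q = t + S q" if "a \<le> q" for q
    using inv[OF that] that a by (auto simp: S_def)
  have contS: "continuous_on {a..} S" unfolding S_def using a by (intro continuous_intros) auto
  define b where "b u = (posterior_mean r p (t + u) (Z (t + u)) - Z (t + u)) / (1 - (t + u))" for u
  have contZ: "continuous_on {0..<1 - t} (\<lambda>u. Z (t + u))"
    by (rule continuous_on_compose2[OF Z]) (auto intro!: continuous_intros)
  have contb: "continuous_on {0..<1 - t} b"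
    unfolding b_def posterior_mean_eq_tanh[OF p] using contZ
    by (intro continuous_intros) auto
  have "((\<lambda>q. q * Z (1 - 1 / q) - q * W (S q)) has_real_derivative
      r * tanh (r * (q * Z (1 - 1 / q)) + half_log_odds p) - W (S q)) (at q within {a..})"
    if q: "a \<le> q" for q
  proof -
    have "0 < q" using a q by simp
    \<comment> \<open>\<open>b\<close> is known to be continuous only on a half-open interval;
      stopping at a slightly later clock time gives a compact interval for the fundamental theorem
      of calculus.\<close>
    define q' where "q' = q + 1"
    define I where "I s = integral {0..s} b" for s
    have "continuous_on {0..S q'} b"
      using contb S(2)[of q'] q by (elim continuous_on_subset) (auto simp: q'_def)
    moreover have "S q \<le> S q'" using \<open>0 < q\<close> by (simp add: S_def q'_def divide_left_mono)
    ultimately have "(I has_real_derivative b (S q)) (at (S q) within {0..S q'})"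
      unfolding I_def using S[OF q] by (intro integral_has_real_derivative) auto
    then have "(I has_real_derivative b (S q)) (at (S q) within S ` {a..q'})"
    proof (rule DERIV_subset)
      have "S x \<le> S q'" if "a \<le> x" "x \<le> q'" for x
        using that a by (simp add: S_def divide_left_mono)
      then show "S ` {a..q'} \<subseteq> {0..S q'}" using S(1) by auto
    qed
    moreover have "(S has_real_derivative 1 / q\<^sup>2) (at q within {a..q'})"
      unfolding S_def using \<open>0 < q\<close>
      by (auto intro!: derivative_eq_intros simp: power2_eq_square)
    ultimately have "(I \<circ> S has_real_derivative b (S q) * (1 / q\<^sup>2)) (at q within {a..q'})"
      by (rule DERIV_image_chain)
    then have IS: "((\<lambda>q. I (S q)) has_real_derivative b (S q) * (1 / q\<^sup>2)) (at q within {a..q'})"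
      by (simp add: o_def)
    have "((\<lambda>q. q * (z + (I \<circ> S) q)) has_real_derivative (z + I (S q)) + q * (b (S q) * (1 / q\<^sup>2)))
        (at q within {a..q'})"
      unfolding o_def by (rule derivative_eq_intros IS refl)+ simp
    also have "at q within {a..q'} = at q within {a..}"
      by (rule at_within_nhd[of _ "{..<q'}"]) (auto simp: q'_def)
    finally have *: "((\<lambda>q. q * (z + (I \<circ> S) q)) has_real_derivative
        (z + I (S q)) + q * (b (S q) * (1 / q\<^sup>2))) (at q within {a..})" .
    have G: "q * (z + (I \<circ> S) q) = q * Z (1 - 1 / q) - q * W (S q)" if "a \<le> q" for q
      unfolding S(3)[OF that] using eq[of "S q"] S(1,2)[OF that] by (simp add: I_def b_def[abs_def] distrib_left)
    have "1 - (t + S q) = 1 / q" by (simp add: S_def)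
    then have "q * (b (S q) * (1 / q\<^sup>2))
        = r * tanh (r * (q * Z (1 - 1 / q)) + half_log_odds p) - Z (1 - 1 / q)"
      using \<open>0 < q\<close> unfolding b_def posterior_mean_eq_tanh[OF p] S(3)[OF q, symmetric]
      by (simp add: power2_eq_square mult.commute)
    moreover have "z + I (S q) = Z (1 - 1 / q) - W (S q)"
      using eq[of "S q"] S[OF q] by (simp add: I_def b_def[abs_def])
    ultimately show ?thesis
      using * q by (intro has_field_derivative_transform_within[OF _ zero_less_one _ G]) auto
  qed
  moreover have "continuous_on {a..} (\<lambda>q. W (S q))"
    by (rule continuous_on_compose2[OF W contS]) (auto simp: S)
  moreover have "continuous_on {a..} (\<lambda>q. q * Z (1 - 1 / q))"
  proof -
    have "continuous_on {a..} (\<lambda>q. Z (t + S q))"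
      by (rule continuous_on_compose2[OF contZ contS]) (auto simp: S)
    then have "continuous_on {a..} (\<lambda>q. q * Z (t + S q))" by (intro continuous_intros)
    then show ?thesis by (rule continuous_on_eq) (simp add: S)
  qed
  ultimately show ?thesis by (simp add: drift_path_def a_def S_def[abs_def])
qed

locale bridge =
  fixes r p t z :: real and M :: "'a measure" and W Z :: "real \<Rightarrow> 'a \<Rightarrow> real"
  assumes r: "0 < r" and p: "0 < p" "p < 1" and t: "t < 1"
    and sol: "bridge_solution r p t z M W Z"
begin

lemma brownian: "brownian_motion M W"
  using sol by (simp add: bridge_solution_def)

sublocale prob_space M
  using brownian by (simp add: brownian_motion_def)

definition q\<^sub>0 :: real where "q\<^sub>0 = 1 / (1 - t)"

definition c :: real where "c = half_log_odds p"

definition Y :: "real \<Rightarrow> 'a \<Rightarrow> real" where "Y q \<omega> = q * Z (1 - 1 / q) \<omega>"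

definition w :: "real \<Rightarrow> 'a \<Rightarrow> real" where "w q \<omega> = W (1 - t - 1 / q) \<omega>"

lemma q\<^sub>0: "0 < q\<^sub>0" "1 / q\<^sub>0 = 1 - t"
  using t by (auto simp: q\<^sub>0_def)

lemma clock:
  assumes "q\<^sub>0 \<le> q"
  shows "0 < q" "1 / q \<le> 1 - t" "0 < 1 / q"
proof -
  show "0 < q" using assms q\<^sub>0 by simp
  then show "0 < 1 / q" by simp
  show "1 / q \<le> 1 - t" unfolding q\<^sub>0(2)[symmetric] using assms q\<^sub>0(1) by (intro divide_left_mono) auto
qed

lemma Z_measurable: "t \<le> u \<Longrightarrow> u \<le> 1 \<Longrightarrow> Z u \<in> borel_measurable M"
  using sol by (simp add: bridge_solution_def)

lemma Y_measurable: "q\<^sub>0 \<le> q \<Longrightarrow> Y q \<in> borel_measurable M"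
  unfolding Y_def[abs_def] using clock[of q]
  by (intro borel_measurable_times borel_measurable_const Z_measurable) auto

lemma AE_drift_path: "AE \<omega> in M. drift_path r c q\<^sub>0 (\<lambda>q. w q \<omega>) (\<lambda>q. Y q \<omega>) \<and> Y q\<^sub>0 \<omega> = z * q\<^sub>0"
proof -
  have "AE \<omega> in M. \<forall>s\<in>{0..<1 - t}. Z (t + s) \<omega> = z + integral {0..s}
                (\<lambda>u. (posterior_mean r p (t + u) (Z (t + u) \<omega>) - Z (t + u) \<omega>) / (1 - (t + u))) + W s \<omega>"
    using sol by (simp add: bridge_solution_def)
  moreover have "AE \<omega> in M. W 0 \<omega> = 0" using brownian by (simp add: brownian_motion_def)
  ultimately show ?thesis using AE_space[of M]
  proof eventually_elim
    case (elim \<omega>)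
    have "continuous_on {t..<1} (\<lambda>u. Z u \<omega>)" "continuous_on {0..} (\<lambda>s. W s \<omega>)"
      using sol elim(3) by (auto simp: bridge_solution_def brownian_motion_def)
    then have "drift_path r c q\<^sub>0 (\<lambda>q. w q \<omega>) (\<lambda>q. Y q \<omega>)"
      unfolding c_def q\<^sub>0_def w_def Y_def
      using elim(1) t p by (intro drift_path_time_change) auto
    moreover have "Z t \<omega> = z" using elim(1,2) t by (auto dest: bspec[of _ _ 0])
    then have "Y q\<^sub>0 \<omega> = z * q\<^sub>0" using q\<^sub>0 by (simp add: Y_def)
    ultimately show ?case by simp
  qed
qed

text \<open>Dynkin's formula for a bounded eigenfunction. The Euler expectation over n steps is (1 -
  mu L / n)^n times the initial value up to O(1 / sqrt n); the scheme converges almost surely to Y,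
  and dominated convergence carries the expectations along.\<close>

lemma generator_expectation:
  fixes \<phi> :: "real \<Rightarrow> real"
  assumes L: "0 < L" and \<mu>: "0 \<le> \<mu>"
    and der: "\<And>x. (\<phi> has_real_derivative \<phi>1 x) (at x)" "\<And>x. (\<phi>1 has_real_derivative \<phi>2 x) (at x)"
      "\<And>x. (\<phi>2 has_real_derivative \<phi>3 x) (at x)"
    and K: "\<And>x. \<bar>\<phi> x\<bar> \<le> K" "\<And>x. \<bar>\<phi>2 x\<bar> \<le> K" "\<And>x. \<bar>\<phi>3 x\<bar> \<le> K" "r \<le> K"
    and generator: "\<And>x. \<phi>1 x * (r * tanh (r * x + c)) + \<phi>2 x / 2 = - \<mu> * \<phi> x"
  shows "expectation (\<lambda>\<omega>. \<phi> (Y (q\<^sub>0 + L) \<omega>)) = exp (- \<mu> * L) * \<phi> (z * q\<^sub>0)"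
proof -
  define g where "g x = r * tanh (r * x + c)" for x
  have gK: "\<bar>g x\<bar> \<le> K" for x
  proof -
    have "\<bar>g x\<bar> = r * \<bar>tanh (r * x + c)\<bar>" using r by (simp add: g_def abs_mult)
    also have "\<dots> \<le> r * 1" using tanh_real_bounds[of "r * x + c"] r by (intro mult_left_mono) auto
    finally show ?thesis using K(4) by simp
  qed
  have gm[measurable]: "g \<in> borel_measurable borel"
    unfolding g_def by (intro borel_measurable_continuous_onI continuous_intros) auto
  have cont\<phi>: "continuous_on UNIV \<phi>"
    using der(1) by (meson DERIV_isCont continuous_at_imp_continuous_on)
  have \<phi>m[measurable]: "\<phi> \<in> borel_measurable borel"
    using cont\<phi> by (rule borel_measurable_continuous_onI)
  define q where "q n k = q\<^sub>0 + real k * (L / real n)" for n k :: nat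
  \<comment> \<open>Between clock times u < v the increment of \<open>w\<close> has variance 1 / u -
    1 / v = (v - u) / (u v). The factor sqrt (u v) turns this into L / n on every step.\<close>
  define \<xi> where "\<xi> n k \<omega> = sqrt (q n k * q n (Suc k)) * (w (q n (Suc k)) \<omega> - w (q n k) \<omega>)" for n k \<omega>
  define E where "E n \<omega> = euler_scheme g (L / n) (z * q\<^sub>0) (\<lambda>k. \<xi> n k \<omega>) n" for n \<omega>
  define C where "C = K ^ 3 / 2 + 2 * K / 3 * (K ^ 3 + 2)"
  have qn: "q\<^sub>0 \<le> q n k" for n k using L by (simp add: q_def)
  have ind: "indep_vars (\<lambda>_. borel) (\<xi> n) {..<n}" for n
  proof -
    define s where "s k = 1 - t - 1 / q n k" for k
    have "0 \<le> s 0" using q\<^sub>0 by (simp add: s_def q_def)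
    moreover have "s k \<le> s (Suc k)" for k
    proof -
      have "q n (Suc k) = q n k + L / n" by (simp add: q_def distrib_right add_divide_distrib)
      then have "q n k \<le> q n (Suc k)" using L by simp
      then show ?thesis using clock(1)[OF qn[of n k]] clock(1)[OF qn[of n "Suc k"]]
        by (simp add: s_def divide_left_mono)
    qed
    ultimately have "indep_vars (\<lambda>_. borel) (\<lambda>k \<omega>. W (s (Suc k)) \<omega> - W (s k) \<omega>) {..<n}"
      using brownian unfolding brownian_motion_def by blast
    then have "indep_vars (\<lambda>_. borel) (\<lambda>k \<omega>. sqrt (q n k * q n (Suc k)) * (W (s (Suc k)) \<omega> - W (s k) \<omega>)) {..<n}"
      by (rule indep_vars_compose2) auto
    then show ?thesis by (simp add: \<xi>_def[abs_def] w_def s_def)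
  qed
  have dist: "distributed M lborel (\<xi> n k) (normal_density 0 (sqrt (L / n)))" if "0 < n" for n k
  proof -
    define u v where "u = q n k" and "v = q n (Suc k)"
    have uv: "0 < u" "u < v" "v - u = L / n"
      using clock(1)[OF qn[of n k]] L that by (auto simp: u_def v_def q_def field_simps)
    have "0 \<le> 1 - t - 1 / u" using clock(2)[OF qn[of n k]] by (simp add: u_def)
    moreover have "1 / v < 1 / u" using uv by (intro divide_strict_left_mono) auto
    ultimately have "distributed M lborel (\<lambda>\<omega>. w v \<omega> - w u \<omega>)
        (normal_density 0 (sqrt ((1 - t - 1 / v) - (1 - t - 1 / u))))"
      unfolding w_def by (intro brownian_motion_increment[OF brownian]) auto
    then have "distributed M lborel (\<lambda>\<omega>. 0 + sqrt (u * v) * (w v \<omega> - w u \<omega>))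
        (normal_density (0 + sqrt (u * v) * 0) (\<bar>sqrt (u * v)\<bar> * sqrt ((1 - t - 1 / v) - (1 - t - 1 / u))))"
      using uv \<open>1 / v < 1 / u\<close> by (intro normal_density_affine) auto
    moreover have "\<bar>sqrt (u * v)\<bar> * sqrt ((1 - t - 1 / v) - (1 - t - 1 / u)) = sqrt (L / n)"
    proof -
      have "0 < v" using uv by simp
      then have "u * v * ((1 - t - 1 / v) - (1 - t - 1 / u)) = v - u"
        using \<open>0 < u\<close> by (simp add: field_simps)
      then show ?thesis using uv by (simp flip: real_sqrt_mult)
    qed
    ultimately show ?thesis by (simp add: \<xi>_def[abs_def] u_def v_def)
  qed
  have Em[measurable]: "E n \<in> borel_measurable M" for n
    unfolding E_def[abs_def] using ind[of n]
    by (intro euler_scheme_measurable gm) (auto simp: indep_vars_def)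
  have "AE \<omega> in M. (\<lambda>n. E n \<omega>) \<longlonglongrightarrow> Y (q\<^sub>0 + L) \<omega>"
    using AE_drift_path
  proof eventually_elim
    case (elim \<omega>)
    show ?case
      using euler_scheme_tendsto[of r c q\<^sub>0 "\<lambda>q. w q \<omega>" "\<lambda>q. Y q \<omega>" L "\<lambda>n k. \<xi> n k \<omega>"] elim q\<^sub>0(1) L
      by (simp add: E_def \<xi>_def q_def g_def[abs_def])
  qed
  then have "AE \<omega> in M. (\<lambda>n. \<phi> (E n \<omega>)) \<longlonglongrightarrow> \<phi> (Y (q\<^sub>0 + L) \<omega>)"
  proof eventually_elim
    case (elim \<omega>)
    then show ?case by (rule isCont_tendsto_compose[OF DERIV_isCont[OF der(1)]])
  qed
  then have lim1: "(\<lambda>n. expectation (\<lambda>\<omega>. \<phi> (E n \<omega>))) \<longlonglongrightarrow> expectation (\<lambda>\<omega>. \<phi> (Y (q\<^sub>0 + L) \<omega>))"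
    using Y_measurable[of "q\<^sub>0 + L"] L K(1)
    by (intro integral_dominated_convergence[where w = "\<lambda>_. K"]) auto
  have bound: "eventually (\<lambda>n. \<bar>expectation (\<lambda>\<omega>. \<phi> (E n \<omega>)) - (1 - \<mu> * (L / n)) ^ n * \<phi> (z * q\<^sub>0)\<bar>
      \<le> C * L * sqrt (L / n)) sequentially"
  proof -
    \<comment> \<open>From this \<open>N\<close> on, both L / n and mu L / n are at most 1, as the
      one-step estimate requires.\<close>
    obtain N :: nat where N: "L + \<mu> * L < N" using reals_Archimedean2 by blast
    have "\<bar>expectation (\<lambda>\<omega>. \<phi> (E n \<omega>)) - (1 - \<mu> * (L / n)) ^ n * \<phi> (z * q\<^sub>0)\<bar> \<le> C * L * sqrt (L / n)"
      if "N \<le> n" for n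
    proof -
      have "0 \<le> \<mu> * L" using \<mu> L by simp
      then have n: "0 < n" "L \<le> n" "\<mu> * L \<le> n" using N L that by (auto simp: Suc_le_eq intro: gr0I)
      have "\<bar>expectation (\<lambda>\<omega>. \<phi> (E n \<omega>)) - (1 - \<mu> * (L / n)) ^ n * \<phi> (z * q\<^sub>0)\<bar>
          \<le> n * (C * (L / n * sqrt (L / n)))"
        unfolding E_def C_def
        by (rule euler_scheme_expectation[OF ind dist _ _ \<mu> _ der K(1-3) gK gm])
          (use n L generator in \<open>auto simp: g_def\<close>)
      also have "\<dots> = C * L * sqrt (L / n)" using n by simp
      finally show ?thesis .
    qed
    then show ?thesis by (auto simp: eventually_sequentially)
  qed
  have "(\<lambda>n. C * L * sqrt (L / n)) \<longlonglongrightarrow> C * L * sqrt 0"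
    by (intro tendsto_intros real_tendsto_divide_at_top[OF tendsto_const] filterlim_real_sequentially)
  then have "(\<lambda>n. C * L * sqrt (L / n)) \<longlonglongrightarrow> 0" by simp
  with bound have "(\<lambda>n. expectation (\<lambda>\<omega>. \<phi> (E n \<omega>)) - (1 - \<mu> * (L / n)) ^ n * \<phi> (z * q\<^sub>0)) \<longlonglongrightarrow> 0"
    unfolding real_norm_def[symmetric] by (rule Lim_null_comparison)
  moreover have "(\<lambda>n. (1 - \<mu> * (L / n)) ^ n * \<phi> (z * q\<^sub>0)) \<longlonglongrightarrow> exp (- \<mu> * L) * \<phi> (z * q\<^sub>0)"
    using tendsto_exp_limit_sequentially[of "- \<mu> * L"] by (intro tendsto_mult_right) simp
  ultimately have "(\<lambda>n. expectation (\<lambda>\<omega>. \<phi> (E n \<omega>))) \<longlonglongrightarrow> 0 + exp (- \<mu> * L) * \<phi> (z * q\<^sub>0)"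
    using tendsto_add by fastforce
  then show ?thesis using LIMSEQ_unique[OF lim1] by simp
qed

text \<open>The four expressions are the second and third derivatives of tanh (r x + c) and sech (r
  x + c), with \<open>T\<close> and \<open>S\<close> the values of these two functions. The summands
  1 and r of \<open>K\<close> dominate the functions themselves and the drift.\<close>

lemma tanh_sech_bounds:
  fixes T S :: real
  assumes "\<bar>T\<bar> \<le> 1" "\<bar>S\<bar> \<le> 1"
  defines "K \<equiv> 1 + r + 2 * r\<^sup>2 + 5 * r ^ 3"
  shows "\<bar>- 2 * r\<^sup>2 * T * (1 - T\<^sup>2)\<bar> \<le> K" "\<bar>- 2 * r ^ 3 * (1 - T\<^sup>2) * (1 - 3 * T\<^sup>2)\<bar> \<le> K"
    "\<bar>r\<^sup>2 * S * (2 * T\<^sup>2 - 1)\<bar> \<le> K" "\<bar>r ^ 3 * S * T * (5 - 6 * T\<^sup>2)\<bar> \<le> K"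
proof -
  have T2: "0 \<le> T\<^sup>2" "T\<^sup>2 \<le> 1" using assms(1) by (auto simp: abs_square_le_1)
  have T2': "\<bar>1 - T\<^sup>2\<bar> \<le> 1" "\<bar>1 - 3 * T\<^sup>2\<bar> \<le> 2" "\<bar>2 * T\<^sup>2 - 1\<bar> \<le> 1" "\<bar>5 - 6 * T\<^sup>2\<bar> \<le> 5"
    using T2 unfolding abs_le_iff by linarith+
  have *: "\<bar>u\<bar> * \<bar>v\<bar> \<le> 1 * b" if "\<bar>u\<bar> \<le> 1" "\<bar>v\<bar> \<le> b" for u v b :: real
    using that by (intro mult_mono) auto
  have K: "2 * r\<^sup>2 \<le> K" "4 * r ^ 3 \<le> K" "r\<^sup>2 \<le> K" "5 * r ^ 3 \<le> K"
    using r by (auto simp: K_def add_increasing)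
  have "\<bar>- 2 * r\<^sup>2 * T * (1 - T\<^sup>2)\<bar> = 2 * r\<^sup>2 * (\<bar>T\<bar> * \<bar>1 - T\<^sup>2\<bar>)" by (simp add: abs_mult)
  also have "\<dots> \<le> 2 * r\<^sup>2 * (1 * 1)" using assms(1) T2' by (intro mult_left_mono *) auto
  finally show "\<bar>- 2 * r\<^sup>2 * T * (1 - T\<^sup>2)\<bar> \<le> K" using K by simp
  have "\<bar>- 2 * r ^ 3 * (1 - T\<^sup>2) * (1 - 3 * T\<^sup>2)\<bar> = 2 * r ^ 3 * (\<bar>1 - T\<^sup>2\<bar> * \<bar>1 - 3 * T\<^sup>2\<bar>)"
    using r by (simp add: abs_mult)
  also have "\<dots> \<le> 2 * r ^ 3 * (1 * 2)" using T2' r by (intro mult_left_mono *) auto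
  finally show "\<bar>- 2 * r ^ 3 * (1 - T\<^sup>2) * (1 - 3 * T\<^sup>2)\<bar> \<le> K" using K by simp
  have "\<bar>r\<^sup>2 * S * (2 * T\<^sup>2 - 1)\<bar> = r\<^sup>2 * (\<bar>S\<bar> * \<bar>2 * T\<^sup>2 - 1\<bar>)" by (simp add: abs_mult)
  also have "\<dots> \<le> r\<^sup>2 * (1 * 1)" using assms(2) T2' by (intro mult_left_mono *) auto
  finally show "\<bar>r\<^sup>2 * S * (2 * T\<^sup>2 - 1)\<bar> \<le> K" using K by simp
  have "\<bar>r ^ 3 * S * T * (5 - 6 * T\<^sup>2)\<bar> = r ^ 3 * (\<bar>S\<bar> * \<bar>T * (5 - 6 * T\<^sup>2)\<bar>)"
    using r by (simp add: abs_mult)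
  also have "\<dots> \<le> r ^ 3 * (1 * (1 * 5))"
    unfolding abs_mult[of T] using assms(1,2) T2' r by (intro mult_left_mono mult_mono) auto
  finally show "\<bar>r ^ 3 * S * T * (5 - 6 * T\<^sup>2)\<bar> \<le> K" using K by simp
qed

section \<open>Eigenfunctions of the generator\<close>

lemma has_derivative_tanh_affine:
  "((\<lambda>x. tanh (r * x + c)) has_real_derivative r * (1 - tanh (r * x + c) ^ 2)) (at x)"
  by (auto intro!: derivative_eq_intros simp: algebra_simps)

lemma has_derivative_sech_affine:
  "((\<lambda>x. 1 / cosh (r * x + c)) has_real_derivative - r * (1 / cosh (r * x + c)) * tanh (r * x + c)) (at x)"
  by (auto intro!: derivative_eq_intros simp: tanh_def power2_eq_square)

lemma expectation_tanh:
  assumes "0 < L"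
  shows "expectation (\<lambda>\<omega>. tanh (r * Y (q\<^sub>0 + L) \<omega> + c)) = tanh (r * (z * q\<^sub>0) + c)"
proof -
  define T where "T x = tanh (r * x + c)" for x
  have T: "\<bar>T x\<bar> \<le> 1" for x using tanh_real_bounds[of "r * x + c"] by (auto simp: T_def)
  have T': "(T has_real_derivative r * (1 - (T x)\<^sup>2)) (at x)" for x
    unfolding T_def[abs_def] by (rule has_derivative_tanh_affine)
  have "expectation (\<lambda>\<omega>. T (Y (q\<^sub>0 + L) \<omega>)) = exp (- 0 * L) * T (z * q\<^sub>0)"
  proof (rule generator_expectation[OF assms order_refl T'])
    show "((\<lambda>x. r * (1 - (T x)\<^sup>2)) has_real_derivative - 2 * r\<^sup>2 * T x * (1 - (T x)\<^sup>2)) (at x)" for x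
      by (rule derivative_eq_intros T' refl)+ (simp add: power2_eq_square algebra_simps)
    show "((\<lambda>x. - 2 * r\<^sup>2 * T x * (1 - (T x)\<^sup>2)) has_real_derivative
        - 2 * r ^ 3 * (1 - (T x)\<^sup>2) * (1 - 3 * (T x)\<^sup>2)) (at x)" for x
      by (rule derivative_eq_intros T' refl)+ (simp add: power2_eq_square power3_eq_cube algebra_simps)
    show "\<bar>- 2 * r\<^sup>2 * T x * (1 - (T x)\<^sup>2)\<bar> \<le> 1 + r + 2 * r\<^sup>2 + 5 * r ^ 3"
      "\<bar>- 2 * r ^ 3 * (1 - (T x)\<^sup>2) * (1 - 3 * (T x)\<^sup>2)\<bar> \<le> 1 + r + 2 * r\<^sup>2 + 5 * r ^ 3" for x
      using tanh_sech_bounds[OF T T] by auto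
    have "1 \<le> 1 + r + 2 * r\<^sup>2 + 5 * r ^ 3" using r by simp
    with T show "\<bar>T x\<bar> \<le> 1 + r + 2 * r\<^sup>2 + 5 * r ^ 3" for x by (rule order_trans)
    show "r \<le> 1 + r + 2 * r\<^sup>2 + 5 * r ^ 3" using r by simp
    show "r * (1 - (T x)\<^sup>2) * (r * tanh (r * x + c)) + - 2 * r\<^sup>2 * T x * (1 - (T x)\<^sup>2) / 2 = - 0 * T x" for x
      unfolding T_def[symmetric] by (simp add: power2_eq_square field_simps)
  qed
  then show ?thesis by (simp add: T_def)
qed

lemma expectation_sech:
  assumes "0 < L"
  shows "expectation (\<lambda>\<omega>. 1 / cosh (r * Y (q\<^sub>0 + L) \<omega> + c)) = exp (- (r\<^sup>2 / 2) * L) * (1 / cosh (r * (z * q\<^sub>0) + c))"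
proof -
  define T S where "T x = tanh (r * x + c)" and "S x = 1 / cosh (r * x + c)" for x
  have T: "\<bar>T x\<bar> \<le> 1" for x using tanh_real_bounds[of "r * x + c"] by (auto simp: T_def)
  have S: "\<bar>S x\<bar> \<le> 1" for x using cosh_real_ge_1[of "r * x + c"] by (simp add: S_def)
  have T': "(T has_real_derivative r * (1 - (T x)\<^sup>2)) (at x)" for x
    unfolding T_def[abs_def] by (rule has_derivative_tanh_affine)
  have S': "(S has_real_derivative - r * S x * T x) (at x)" for x
    unfolding T_def S_def[abs_def] by (rule has_derivative_sech_affine)
  have "expectation (\<lambda>\<omega>. S (Y (q\<^sub>0 + L) \<omega>)) = exp (- (r\<^sup>2 / 2) * L) * S (z * q\<^sub>0)"
  proof (rule generator_expectation[OF assms _ S'])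
    show "((\<lambda>x. - r * S x * T x) has_real_derivative r\<^sup>2 * S x * (2 * (T x)\<^sup>2 - 1)) (at x)" for x
      by (rule derivative_eq_intros T' S' refl)+ (simp add: power2_eq_square algebra_simps)
    show "((\<lambda>x. r\<^sup>2 * S x * (2 * (T x)\<^sup>2 - 1)) has_real_derivative
        r ^ 3 * S x * T x * (5 - 6 * (T x)\<^sup>2)) (at x)" for x
      by (rule derivative_eq_intros T' S' refl)+ (simp add: power2_eq_square power3_eq_cube algebra_simps)
    show "\<bar>r\<^sup>2 * S x * (2 * (T x)\<^sup>2 - 1)\<bar> \<le> 1 + r + 2 * r\<^sup>2 + 5 * r ^ 3"
      "\<bar>r ^ 3 * S x * T x * (5 - 6 * (T x)\<^sup>2)\<bar> \<le> 1 + r + 2 * r\<^sup>2 + 5 * r ^ 3" for x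
      using tanh_sech_bounds[OF T S] by auto
    have "1 \<le> 1 + r + 2 * r\<^sup>2 + 5 * r ^ 3" using r by simp
    with S show "\<bar>S x\<bar> \<le> 1 + r + 2 * r\<^sup>2 + 5 * r ^ 3" for x by (rule order_trans)
    show "r \<le> 1 + r + 2 * r\<^sup>2 + 5 * r ^ 3" using r by simp
    show "- r * S x * T x * (r * tanh (r * x + c)) + r\<^sup>2 * S x * (2 * (T x)\<^sup>2 - 1) / 2 = - (r\<^sup>2 / 2) * S x" for x
      unfolding T_def[symmetric] by (simp add: power2_eq_square algebra_simps diff_divide_distrib)
  qed simp
  then show ?thesis by (simp add: S_def)
qed

section \<open>Values of stopping problems\<close>

lemma Z_eq: "0 < q \<Longrightarrow> Z (1 - 1 / q) \<omega> = Y q \<omega> / q"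
  by (simp add: Y_def)

lemma ex_clock:
  assumes "t \<le> u" "u < 1"
  obtains q where "q\<^sub>0 \<le> q" "u = 1 - 1 / q"
proof -
  have "q\<^sub>0 \<le> 1 / (1 - u)" unfolding q\<^sub>0_def using assms by (intro divide_left_mono) auto
  then show thesis by (rule that) simp
qed

text \<open>Dividing by \<open>q\<close> and letting it tend to infinity removes the intercept
  \<open>A\<close>: only the slope of a linear lower bound survives at time 1.\<close>

lemma Z_1_ge:
  assumes lim: "((\<lambda>u. Z u \<omega>) \<longlongrightarrow> Z 1 \<omega>) (at_left 1)"
    and lower: "\<And>q. q\<^sub>1 \<le> q \<Longrightarrow> A + B * q \<le> Y q \<omega>"
  shows "B \<le> Z 1 \<omega>"
proof -
  have inv: "((\<lambda>q. x / q) \<longlongrightarrow> 0) at_top" for x :: real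
    by (intro tendsto_divide_0[OF tendsto_const] filterlim_at_top_imp_at_infinity filterlim_ident)
  have "((\<lambda>q. 1 - 1 / q) \<longlongrightarrow> 1 - 0) (at_top :: real filter)"
    by (intro tendsto_intros inv)
  moreover have "eventually (\<lambda>q :: real. 1 - 1 / q \<in> {..<1} \<and> 1 - 1 / q \<noteq> 1) at_top"
    using eventually_gt_at_top[of 0] by eventually_elim simp
  ultimately have "filterlim (\<lambda>q. 1 - 1 / q) (at_left 1) (at_top :: real filter)"
    unfolding filterlim_at diff_zero by blast
  then have "((\<lambda>q. Z (1 - 1 / q) \<omega>) \<longlongrightarrow> Z 1 \<omega>) at_top"
    by (rule filterlim_compose[OF lim])
  moreover have "((\<lambda>q. A / q + B) \<longlongrightarrow> 0 + B) at_top" by (intro tendsto_intros inv)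
  moreover have "eventually (\<lambda>q. A / q + B \<le> Z (1 - 1 / q) \<omega>) at_top"
    using eventually_ge_at_top[of q\<^sub>1] eventually_gt_at_top[of 0]
  proof eventually_elim
    case (elim q)
    have "(A + B * q) / q \<le> Y q \<omega> / q" using elim lower[of q] by (intro divide_right_mono) auto
    then show ?case using elim by (simp add: Z_eq add_divide_distrib)
  qed
  ultimately show ?thesis by (intro tendsto_le[of at_top]) auto
qed

text \<open>A linear bound on \<open>Y\<close> without intercept is a constant bound on
  \<open>Z\<close> before time 1; the left limit extends it to time 1.\<close>

lemma Z_le:
  assumes lim: "((\<lambda>u. Z u \<omega>) \<longlongrightarrow> Z 1 \<omega>) (at_left 1)"
    and upper: "\<And>q. q\<^sub>0 \<le> q \<Longrightarrow> Y q \<omega> \<le> B * q" and u: "t \<le> u" "u \<le> 1"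
  shows "Z u \<omega> \<le> B"
proof -
  have less: "Z u \<omega> \<le> B" if "t \<le> u" "u < 1" for u
  proof -
    obtain q where q: "q\<^sub>0 \<le> q" "u = 1 - 1 / q" by (rule ex_clock[OF \<open>t \<le> u\<close> \<open>u < 1\<close>])
    then show ?thesis using upper[of q] clock(1)[of q] by (simp add: Z_eq pos_divide_le_eq)
  qed
  moreover have "Z 1 \<omega> \<le> B"
  proof (rule tendsto_upperbound[OF lim])
    show "eventually (\<lambda>u. Z u \<omega> \<le> B) (at_left 1)"
      unfolding eventually_at_left_field using t less by (intro exI[of _ t]) auto
  qed simp
  ultimately show ?thesis using u by (cases "u = 1") auto
qed

lemma Z_ge:
  assumes lim: "((\<lambda>u. Z u \<omega>) \<longlongrightarrow> Z 1 \<omega>) (at_left 1)"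
    and lower: "\<And>q. q\<^sub>0 \<le> q \<Longrightarrow> B * q \<le> Y q \<omega>" and u: "t \<le> u" "u \<le> 1"
  shows "B \<le> Z u \<omega>"
proof (cases "u = 1")
  case True
  then show ?thesis using Z_1_ge[OF lim, of q\<^sub>0 0 B] lower by simp
next
  case False
  then obtain q where "q\<^sub>0 \<le> q" "u = 1 - 1 / q" using u by (auto elim: ex_clock)
  then show ?thesis using lower[of q] clock(1)[of q] by (simp add: Z_eq pos_le_divide_eq)
qed

text \<open>Gathers the almost sure properties of a trajectory, so that the estimates that follow
  are deterministic; \<open>R\<close> is the value of the noise bound on that trajectory.\<close>

definition regular :: "'a \<Rightarrow> real \<Rightarrow> bool" where
  "regular \<omega> R \<longleftrightarrow> drift_path r c q\<^sub>0 (\<lambda>q. w q \<omega>) (\<lambda>q. Y q \<omega>) \<and> Y q\<^sub>0 \<omega> = z * q\<^sub>0 \<and>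
     ((\<lambda>u. Z u \<omega>) \<longlongrightarrow> Z 1 \<omega>) (at_left 1) \<and> 0 \<le> R \<and> (\<forall>q\<ge>q\<^sub>0. \<bar>w q \<omega>\<bar> \<le> R)"

lemma regularD:
  assumes "regular \<omega> R"
  shows "drift_path r c q\<^sub>0 (\<lambda>q. w q \<omega>) (\<lambda>q. Y q \<omega>)" "Y q\<^sub>0 \<omega> = z * q\<^sub>0"
    "((\<lambda>u. Z u \<omega>) \<longlongrightarrow> Z 1 \<omega>) (at_left 1)" "0 \<le> R" "\<And>q. q\<^sub>0 \<le> q \<Longrightarrow> \<bar>w q \<omega>\<bar> \<le> R"
  using assms by (auto simp: regular_def)

lemma ex_noise_bound:
  obtains R where "integrable M R" "expectation R \<le> 40 * sqrt (1 - t)" "AE \<omega> in M. regular \<omega> (R \<omega>)"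
proof -
  obtain R where R: "integrable M R" "\<And>\<omega>. 0 \<le> R \<omega>" "expectation R \<le> 40 * sqrt (1 - t)"
    "AE \<omega> in M. \<forall>s\<in>{0..1 - t}. \<bar>W s \<omega>\<bar> \<le> R \<omega>"
    using brownian_motion_maximal[OF brownian, of "1 - t"] t by auto
  have "AE \<omega> in M. ((\<lambda>u. Z u \<omega>) \<longlongrightarrow> Z 1 \<omega>) (at_left 1)" using sol by (simp add: bridge_solution_def)
  with R(4) AE_drift_path have "AE \<omega> in M. regular \<omega> (R \<omega>)"
  proof eventually_elim
    case (elim \<omega>)
    have "\<bar>w q \<omega>\<bar> \<le> R \<omega>" if "q\<^sub>0 \<le> q" for q
      using elim(1) clock[OF that] by (simp add: w_def)
    then show ?case using elim R(2) by (simp add: regular_def)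
  qed
  with R that show thesis by blast
qed

section \<open>Deterministic bounds on regular paths\<close>

lemma regular_upper:
  assumes "regular \<omega> R" "q\<^sub>0 \<le> q"
  shows "Y q \<omega> \<le> z * q\<^sub>0 + r * (q - q\<^sub>0) + 2 * R * q"
  using drift_path_upper[OF regularD(1)[OF assms(1)], of q\<^sub>0 q R] regularD[OF assms(1)] r q\<^sub>0(1) assms(2)
  by simp

lemma regular_lower:
  assumes "regular \<omega> R" "q\<^sub>0 \<le> q"
  shows "z * q\<^sub>0 - r * (q - q\<^sub>0) - 2 * R * q \<le> Y q \<omega>"
  using drift_path_lower[OF regularD(1)[OF assms(1)], of q\<^sub>0 q R] regularD[OF assms(1)] r q\<^sub>0(1) assms(2)
  by simp

text \<open>The left side is \<open>q\<close> times a weighted mean of \<open>x\<close> and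
  \<open>y\<close>: in the original scale, a straight motion from the start \<open>x\<close> towards
  the pin \<open>y\<close>.\<close>

lemma convex_clock_le:
  assumes "q\<^sub>0 \<le> q"
  shows "x * q\<^sub>0 + y * (q - q\<^sub>0) \<le> max x y * q"
proof -
  have "x * q\<^sub>0 \<le> max x y * q\<^sub>0" "y * (q - q\<^sub>0) \<le> max x y * (q - q\<^sub>0)"
    using assms q\<^sub>0(1) by (intro mult_right_mono; simp)+
  then show ?thesis by (simp add: algebra_simps)
qed

lemma regular_Z_le:
  assumes "regular \<omega> R" "t \<le> u" "u \<le> 1"
  shows "Z u \<omega> \<le> max z r + 2 * R"
proof (rule Z_le[OF regularD(3)[OF assms(1)] _ assms(2,3)])
  show "Y q \<omega> \<le> (max z r + 2 * R) * q" if "q\<^sub>0 \<le> q" for q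
    using regular_upper[OF assms(1) that] convex_clock_le[OF that, of z r] by (simp add: algebra_simps)
qed

lemma regular_Z_ge:
  assumes "regular \<omega> R" "t \<le> u" "u \<le> 1"
  shows "- max (- z) r - 2 * R \<le> Z u \<omega>"
proof (rule Z_ge[OF regularD(3)[OF assms(1)] _ assms(2,3)])
  show "(- max (- z) r - 2 * R) * q \<le> Y q \<omega>" if "q\<^sub>0 \<le> q" for q
    using regular_lower[OF assms(1) that] convex_clock_le[OF that, of "- z" r] by (simp add: algebra_simps)
qed

lemma regular_Z_1_ge:
  assumes "regular \<omega> R"
  shows "- r - 2 * R \<le> Z 1 \<omega>"
proof (rule Z_1_ge[OF regularD(3)[OF assms], of q\<^sub>0 "(z + r) * q\<^sub>0"])
  show "(z + r) * q\<^sub>0 + (- r - 2 * R) * q \<le> Y q \<omega>" if "q\<^sub>0 \<le> q" for q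
    using regular_lower[OF assms that] by (simp add: algebra_simps)
qed

text \<open>Rounding the elapsed time down to a grid of mesh 1 / (n + 1) leaves countably many
  times, and path continuity before time 1 gives the limit. Stopping at the horizon is split off,
  because \<open>Z 1\<close> is a left limit only almost surely.\<close>

lemma stopped_measurable:
  assumes "\<tau> \<in> bridge_stopping_times M t Z"
  shows "(\<lambda>\<omega>. Z (t + \<tau> \<omega>) \<omega>) \<in> borel_measurable M"
proof -
  let ?F = "bridge_filtration M t Z"
  have sub: "sets (?F s) \<subseteq> sets M" for s
    unfolding bridge_filtration_def
    by (subst sets_measure_of) (auto intro!: sets.sigma_sets_subset measurable_sets[OF Z_measurable])
  have "space (?F s) = space M" for s
    unfolding bridge_filtration_def by (rule space_measure_of) auto
  with sub have \<tau>m[measurable]: "\<tau> \<in> borel_measurable M"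
    using assms measurable_stopping_time[of ?F \<tau> M] by (auto simp: bridge_stopping_times_def)
  have \<tau>: "0 \<le> \<tau> \<omega>" "\<tau> \<omega> \<le> 1 - t" if "\<omega> \<in> space M" for \<omega>
    using assms that by (auto simp: bridge_stopping_times_def)
  define G where "G i n \<omega> = (if real i / real (Suc n) \<le> 1 - t then Z (t + real i / real (Suc n)) \<omega> else 0)"
    for i n :: nat and \<omega>
  have Gm: "G i n \<in> borel_measurable M" for i n
    unfolding G_def[abs_def] by (cases "real i / real (Suc n) \<le> 1 - t") (auto intro!: Z_measurable)
  define k where "k n \<omega> = nat \<lfloor>real (Suc n) * \<tau> \<omega>\<rfloor>" for n \<omega>
  have km: "k n \<in> measurable M (count_space UNIV)" for n unfolding k_def[abs_def] by measurable
  define X where "X n \<omega> = (if \<tau> \<omega> = 1 - t then Z 1 \<omega> else G (k n \<omega>) n \<omega>)" for n \<omega>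
  have "X n \<in> borel_measurable M" for n
  proof -
    have "(\<lambda>\<omega>. G (k n \<omega>) n \<omega>) \<in> borel_measurable M"
      using Gm km by (rule measurable_compose_countable)
    moreover have "Z 1 \<in> borel_measurable M" using t by (intro Z_measurable) auto
    ultimately show ?thesis unfolding X_def[abs_def] by measurable
  qed
  then show ?thesis
  proof (rule borel_measurable_LIMSEQ_metric)
    fix \<omega> assume \<omega>: "\<omega> \<in> space M"
    show "(\<lambda>n. X n \<omega>) \<longlonglongrightarrow> Z (t + \<tau> \<omega>) \<omega>"
    proof (cases "\<tau> \<omega> = 1 - t")
      case True
      then show ?thesis by (simp add: X_def)
    next
      case False
      with \<tau>[OF \<omega>] have \<tau>': "0 \<le> \<tau> \<omega>" "\<tau> \<omega> < 1 - t" by auto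
      define x where "x n = real (k n \<omega>) / real (Suc n)" for n
      have x: "0 \<le> x n" "x n \<le> \<tau> \<omega>" "\<tau> \<omega> - 1 / real (Suc n) \<le> x n" for n
      proof -
        have "real (k n \<omega>) \<le> real (Suc n) * \<tau> \<omega>" "real (Suc n) * \<tau> \<omega> < real (k n \<omega>) + 1"
          using \<tau>' by (auto simp: k_def)
        then have "real (k n \<omega>) / real (Suc n) \<le> real (Suc n) * \<tau> \<omega> / real (Suc n)"
          "(real (Suc n) * \<tau> \<omega> - 1) / real (Suc n) \<le> real (k n \<omega>) / real (Suc n)"
          by (intro divide_right_mono; simp)+
        moreover have "real (Suc n) * \<tau> \<omega> / real (Suc n) = \<tau> \<omega>" by (rule nonzero_mult_div_cancel_left) simp
        ultimately show "x n \<le> \<tau> \<omega>" "\<tau> \<omega> - 1 / real (Suc n) \<le> x n"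
          unfolding x_def diff_divide_distrib by simp_all
      qed (simp add: x_def)
      have "(\<lambda>n. \<tau> \<omega> - 1 / real (Suc n)) \<longlonglongrightarrow> \<tau> \<omega> - 0"
        using LIMSEQ_inverse_real_of_nat by (intro tendsto_intros) (simp add: inverse_eq_divide)
      then have "x \<longlonglongrightarrow> \<tau> \<omega>"
        using x by (intro tendsto_sandwich[of "\<lambda>n. \<tau> \<omega> - 1 / real (Suc n)" x sequentially "\<lambda>_. \<tau> \<omega>"]) auto
      then have "(\<lambda>n. t + x n) \<longlonglongrightarrow> t + \<tau> \<omega>" by (intro tendsto_intros)
      moreover have "continuous_on {t..<1} (\<lambda>u. Z u \<omega>)"
        using sol \<omega> by (simp add: bridge_solution_def)
      moreover have "t + x n < 1" for n using x(2)[of n] \<tau>' by linarith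
      ultimately have "(\<lambda>n. Z (t + x n) \<omega>) \<longlonglongrightarrow> Z (t + \<tau> \<omega>) \<omega>"
        using x \<tau>' by (intro continuous_on_tendsto_compose[of "{t..<1}" "\<lambda>u. Z u \<omega>"])
          (auto intro!: always_eventually)
      moreover have "X n \<omega> = Z (t + x n) \<omega>" for n
        using False x(2)[of n] \<tau>' by (simp add: X_def G_def x_def)
      ultimately show ?thesis by simp
    qed
  qed
qed

lemma stopped_integrable:
  assumes "\<tau> \<in> bridge_stopping_times M t Z"
  shows "integrable M (\<lambda>\<omega>. Z (t + \<tau> \<omega>) \<omega>)"
proof -
  obtain R where R: "integrable M R" "AE \<omega> in M. regular \<omega> (R \<omega>)" by (rule ex_noise_bound)
  show ?thesis
  proof (rule Bochner_Integration.integrable_bound)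
    show "integrable M (\<lambda>\<omega>. \<bar>z\<bar> + r + 2 * R \<omega>)" using R(1) by auto
    show "AE \<omega> in M. norm (Z (t + \<tau> \<omega>) \<omega>) \<le> norm (\<bar>z\<bar> + r + 2 * R \<omega>)"
      using R(2) AE_space
    proof eventually_elim
      case (elim \<omega>)
      then have "t \<le> t + \<tau> \<omega>" "t + \<tau> \<omega> \<le> 1" using assms by (auto simp: bridge_stopping_times_def)
      from regular_Z_le[OF elim(1) this] regular_Z_ge[OF elim(1) this]
      show ?case using regularD(4)[OF elim(1)] r by (simp add: abs_le_iff max_def abs_if split: if_splits)
    qed
  qed (rule stopped_measurable[OF assms])
qed

lemma zero_stopping: "(\<lambda>_. 0) \<in> bridge_stopping_times M t Z"
  using t by (auto simp: bridge_stopping_times_def intro: stopping_time_const)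

lemma stopping_value_le:
  assumes B: "integrable M B" and bound: "AE \<omega> in M. \<forall>u\<in>{t..1}. Z u \<omega> \<le> B \<omega>"
  shows "stopping_value M t Z \<le> expectation B"
  unfolding stopping_value_def
proof (rule cSUP_least)
  fix \<tau> assume \<tau>: "\<tau> \<in> bridge_stopping_times M t Z"
  show "expectation (\<lambda>\<omega>. Z (t + \<tau> \<omega>) \<omega>) \<le> expectation B"
  proof (rule integral_mono_AE[OF stopped_integrable[OF \<tau>] B])
    show "AE \<omega> in M. Z (t + \<tau> \<omega>) \<omega> \<le> B \<omega>"
      using bound AE_space
    proof eventually_elim
      case (elim \<omega>)
      then have "t + \<tau> \<omega> \<in> {t..1}" using \<tau> by (auto simp: bridge_stopping_times_def)
      with elim(1) show ?case by blast
    qed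
  qed
qed (use zero_stopping in blast)

lemma stopping_value_ge:
  assumes \<tau>: "\<tau> \<in> bridge_stopping_times M t Z" and B: "integrable M B"
    and bound: "AE \<omega> in M. B \<omega> \<le> Z (t + \<tau> \<omega>) \<omega>"
  shows "expectation B \<le> stopping_value M t Z"
proof -
  obtain R where R: "integrable M R" "AE \<omega> in M. regular \<omega> (R \<omega>)" by (rule ex_noise_bound)
  \<comment> \<open>A real supremum dominates its members only when the set is bounded
    above.\<close>
  have "bdd_above ((\<lambda>\<tau>. expectation (\<lambda>\<omega>. Z (t + \<tau> \<omega>) \<omega>)) ` bridge_stopping_times M t Z)"
  proof (rule bdd_aboveI2)
    fix \<tau> assume \<tau>: "\<tau> \<in> bridge_stopping_times M t Z"
    show "expectation (\<lambda>\<omega>. Z (t + \<tau> \<omega>) \<omega>) \<le> expectation (\<lambda>\<omega>. max z r + 2 * R \<omega>)"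
    proof (rule integral_mono_AE[OF stopped_integrable[OF \<tau>]])
      show "AE \<omega> in M. Z (t + \<tau> \<omega>) \<omega> \<le> max z r + 2 * R \<omega>"
        using R(2) AE_space
        by eventually_elim (use \<tau> in \<open>auto simp: bridge_stopping_times_def intro!: regular_Z_le\<close>)
    qed (use R(1) in auto)
  qed
  then have "expectation (\<lambda>\<omega>. Z (t + \<tau> \<omega>) \<omega>) \<le> stopping_value M t Z"
    unfolding stopping_value_def using \<tau> by (rule cSUP_upper[rotated])
  moreover have "expectation B \<le> expectation (\<lambda>\<omega>. Z (t + \<tau> \<omega>) \<omega>)"
    by (rule integral_mono_AE[OF B stopped_integrable[OF \<tau>] bound])
  ultimately show ?thesis by simp
qed

section \<open>Bounds on the value\<close>

lemma expectation_affine_le: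
  fixes R :: "'a \<Rightarrow> real"
  assumes "integrable M R" "expectation R \<le> N" "0 \<le> k"
  shows "expectation (\<lambda>\<omega>. b + k * R \<omega>) \<le> b + k * N"
proof -
  have "expectation (\<lambda>\<omega>. b + k * R \<omega>) = b + k * expectation R"
    using assms(1) by (simp add: prob_space)
  also have "\<dots> \<le> b + k * N" using assms by (intro add_left_mono mult_left_mono)
  finally show ?thesis .
qed

lemma stopping_value_le_max: "stopping_value M t Z \<le> max z r + 2 * (40 * sqrt (1 - t))"
proof -
  obtain R where R: "integrable M R" "expectation R \<le> 40 * sqrt (1 - t)" "AE \<omega> in M. regular \<omega> (R \<omega>)"
    by (rule ex_noise_bound)
  have "stopping_value M t Z \<le> expectation (\<lambda>\<omega>. max z r + 2 * R \<omega>)"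
  proof (rule stopping_value_le)
    show "AE \<omega> in M. \<forall>u\<in>{t..1}. Z u \<omega> \<le> max z r + 2 * R \<omega>"
      using R(3) by eventually_elim (auto intro: regular_Z_le)
  qed (use R in auto)
  also have "\<dots> \<le> max z r + 2 * (40 * sqrt (1 - t))"
    by (rule expectation_affine_le[OF R(1,2)]) simp
  finally show ?thesis .
qed

lemma stopping_value_ge_start: "z \<le> stopping_value M t Z"
proof -
  have "expectation (\<lambda>_. z) \<le> stopping_value M t Z"
  proof (rule stopping_value_ge[OF zero_stopping])
    show "AE \<omega> in M. z \<le> Z (t + 0) \<omega>"
      using AE_drift_path
    proof eventually_elim
      case (elim \<omega>)
      then show ?case using Z_eq[OF q\<^sub>0(1), of \<omega>] q\<^sub>0 by simp
    qed
  qed simp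
  then show ?thesis by (simp add: prob_space)
qed

lemma horizon_stopping: "(\<lambda>_. 1 - t) \<in> bridge_stopping_times M t Z"
  using t by (auto simp: bridge_stopping_times_def intro: stopping_time_const)

lemma stopping_value_ge_lower_pin: "- r - 2 * (40 * sqrt (1 - t)) \<le> stopping_value M t Z"
proof -
  obtain R where R: "integrable M R" "expectation R \<le> 40 * sqrt (1 - t)" "AE \<omega> in M. regular \<omega> (R \<omega>)"
    by (rule ex_noise_bound)
  have "expectation (\<lambda>\<omega>. - r - 2 * R \<omega>) \<le> stopping_value M t Z"
  proof (rule stopping_value_ge[OF horizon_stopping])
    show "AE \<omega> in M. - r - 2 * R \<omega> \<le> Z (t + (1 - t)) \<omega>"
      using R(3) by eventually_elim (simp add: regular_Z_1_ge)
  qed (use R in auto)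
  moreover have "expectation (\<lambda>\<omega>. - r - 2 * R \<omega>) = - r - 2 * expectation R"
    using R(1) by (simp add: prob_space)
  ultimately show ?thesis using R(2) by simp
qed

text \<open>If the noise is at most \<open>\<delta>\<close>, the path keeps its sign and stays below
  a mean of \<open>z\<close> and \<open>- \<rho>\<close>, up to \<open>2 * \<delta>\<close>.
  Otherwise the crude bound \<open>regular_Z_le\<close> applies and its excess is charged to
  \<open>R\<close>.\<close>

lemma stopping_value_le_of_negative:
  assumes "z < 0" "0 < \<delta>"
    and drift: "\<And>y. y \<le> - l \<Longrightarrow> r * tanh (r * y + c) \<le> - \<rho>"
    and large: "0 \<le> min (- z) \<rho> - 2 * \<delta>" "l < (min (- z) \<rho> - 2 * \<delta>) * q\<^sub>0"
  shows "stopping_value M t Z \<le> max z (- \<rho>) + 2 * \<delta> + ((2 * \<bar>z\<bar> + r) / \<delta> + 2) * (40 * sqrt (1 - t))"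
proof -
  obtain R where R: "integrable M R" "expectation R \<le> 40 * sqrt (1 - t)" "AE \<omega> in M. regular \<omega> (R \<omega>)"
    by (rule ex_noise_bound)
  \<comment> \<open>For negative \<open>z\<close> this is at least the gap between
    \<open>max z r\<close> and \<open>max z (- \<rho>)\<close>.\<close>
  define K where "K = 2 * \<bar>z\<bar> + r"
  have K: "0 \<le> K" "0 \<le> K / \<delta>" using r \<open>0 < \<delta>\<close> by (auto simp: K_def)
  have "stopping_value M t Z \<le> expectation (\<lambda>\<omega>. max z (- \<rho>) + 2 * \<delta> + (K / \<delta> + 2) * R \<omega>)"
  proof (rule stopping_value_le)
    show "AE \<omega> in M. \<forall>u\<in>{t..1}. Z u \<omega> \<le> max z (- \<rho>) + 2 * \<delta> + (K / \<delta> + 2) * R \<omega>"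
      using R(3)
    proof eventually_elim
      case (elim \<omega>)
      note reg = regularD[OF elim]
      have KR: "0 \<le> K / \<delta> * R \<omega>" by (rule mult_nonneg_nonneg[OF K(2) reg(4)])
      show ?case
      proof
        fix u assume u: "u \<in> {t..1}"
        show "Z u \<omega> \<le> max z (- \<rho>) + 2 * \<delta> + (K / \<delta> + 2) * R \<omega>"
        proof (cases "R \<omega> \<le> \<delta>")
          case True
          have "Y q \<omega> \<le> (max z (- \<rho>) + 2 * \<delta>) * q" if q: "q\<^sub>0 \<le> q" for q
          proof -
            have "Y q \<omega> \<le> - (- z * q\<^sub>0 + \<rho> * (q - q\<^sub>0) - 2 * \<delta> * q)"
              using q\<^sub>0(1) q large drift reg(2) order_trans[OF reg(5) True]
              by (intro drift_path_stays_below[OF reg(1)]) auto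
            also have "\<dots> \<le> (max z (- \<rho>) + 2 * \<delta>) * q"
              using convex_clock_le[OF q, of z "- \<rho>"] by (simp add: algebra_simps)
            finally show ?thesis .
          qed
          then have "Z u \<omega> \<le> max z (- \<rho>) + 2 * \<delta>"
            using u by (intro Z_le[OF reg(3)]) auto
          then show ?thesis using KR reg(4) by (simp add: distrib_right)
        next
          case False
          have "Z u \<omega> \<le> max z r + 2 * R \<omega>" using u by (intro regular_Z_le[OF elim]) auto
          moreover have "max z r \<le> max z (- \<rho>) + K" using \<open>z < 0\<close> r by (auto simp: K_def max_def)
          moreover have "K \<le> K / \<delta> * R \<omega>" using False K \<open>0 < \<delta>\<close> by (intro le_scaled_excess) auto
          ultimately show ?thesis unfolding distrib_right using \<open>0 < \<delta>\<close> by linarith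
        qed
      qed
    qed
  qed (use R in auto)
  also have "\<dots> \<le> max z (- \<rho>) + 2 * \<delta> + (K / \<delta> + 2) * (40 * sqrt (1 - t))"
    using K by (intro expectation_affine_le[OF R(1,2)]) simp
  finally show ?thesis by (simp add: K_def)
qed

text \<open>The rule is to wait until time 1. For small noise the start contributes only the
  intercept \<open>(z - \<rho>) * q\<^sub>0\<close>, which disappears at time 1, and the slope is at
  least \<open>\<rho> - 2 * \<delta>\<close>. For large noise the worst pin \<open>- r\<close> costs
  at most \<open>2 * r\<close>.\<close>

lemma stopping_value_ge_of_positive:
  assumes "0 < z" "0 < \<delta>" "\<rho> < r"
    and drift: "\<And>y. l \<le> y \<Longrightarrow> \<rho> \<le> r * tanh (r * y + c)"
    and large: "0 \<le> min z \<rho> - 2 * \<delta>" "l < (min z \<rho> - 2 * \<delta>) * q\<^sub>0"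
  shows "\<rho> - 2 * \<delta> - (2 * r / \<delta> + 2) * (40 * sqrt (1 - t)) \<le> stopping_value M t Z"
proof -
  obtain R where R: "integrable M R" "expectation R \<le> 40 * sqrt (1 - t)" "AE \<omega> in M. regular \<omega> (R \<omega>)"
    by (rule ex_noise_bound)
  define K where "K = 2 * r"
  have K: "0 \<le> K" "0 \<le> K / \<delta>" using r \<open>0 < \<delta>\<close> by (auto simp: K_def)
  have "expectation (\<lambda>\<omega>. \<rho> - 2 * \<delta> - (K / \<delta> + 2) * R \<omega>) \<le> stopping_value M t Z"
  proof (rule stopping_value_ge[OF horizon_stopping])
    show "AE \<omega> in M. \<rho> - 2 * \<delta> - (K / \<delta> + 2) * R \<omega> \<le> Z (t + (1 - t)) \<omega>"
      using R(3)
    proof eventually_elim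
      case (elim \<omega>)
      note reg = regularD[OF elim]
      have KR: "0 \<le> K / \<delta> * R \<omega>" by (rule mult_nonneg_nonneg[OF K(2) reg(4)])
      have "\<rho> - 2 * \<delta> - (K / \<delta> + 2) * R \<omega> \<le> Z 1 \<omega>"
      proof (cases "R \<omega> \<le> \<delta>")
        case True
        have "\<rho> - 2 * \<delta> \<le> Z 1 \<omega>"
        proof (rule Z_1_ge[OF reg(3), of q\<^sub>0 "(z - \<rho>) * q\<^sub>0"])
          fix q assume q: "q\<^sub>0 \<le> q"
          have "z * q\<^sub>0 + \<rho> * (q - q\<^sub>0) - 2 * \<delta> * q \<le> Y q \<omega>"
            using q\<^sub>0(1) q large drift reg(2) order_trans[OF reg(5) True]
            by (intro drift_path_stays_above[OF reg(1)]) auto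
          then show "(z - \<rho>) * q\<^sub>0 + (\<rho> - 2 * \<delta>) * q \<le> Y q \<omega>" by (simp add: algebra_simps)
        qed
        then show ?thesis using KR reg(4) by (simp add: distrib_right)
      next
        case False
        then have "K \<le> K / \<delta> * R \<omega>" using K \<open>0 < \<delta>\<close> by (intro le_scaled_excess) auto
        then show ?thesis
          using regular_Z_1_ge[OF elim] \<open>\<rho> < r\<close> \<open>0 < \<delta>\<close> by (simp add: distrib_right K_def)
      qed
      then show ?case by simp
    qed
  qed (use R in auto)
  moreover have "expectation (\<lambda>\<omega>. \<rho> - 2 * \<delta> - (K / \<delta> + 2) * R \<omega>) = \<rho> - 2 * \<delta> - (K / \<delta> + 2) * expectation R"
    using R(1) by (simp add: prob_space)
  moreover have "(K / \<delta> + 2) * expectation R \<le> (K / \<delta> + 2) * (40 * sqrt (1 - t))"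
    using K by (intro mult_left_mono R(2)) simp
  ultimately show ?thesis by (simp add: K_def)
qed

text \<open>
  Started from \<open>0\<close>, the observer waits until the clock reads \<open>q\<^sub>1\<close>, by which time the sign of the
  pinning point is known with high probability although only the fraction \<open>\<theta> / (1 + \<theta>)\<close> of the
  remaining time has been spent. \<open>P\<close> is the posterior probability of \<open>r\<close> at that time, and \<open>S\<close>
  controls the event that the sign is still undecided.
\<close>

definition q\<^sub>1 :: "real \<Rightarrow> real" where "q\<^sub>1 \<theta> = q\<^sub>0 + \<theta> * q\<^sub>0"

definition P :: "real \<Rightarrow> 'a \<Rightarrow> real" where "P \<theta> \<omega> = (1 + tanh (r * Y (q\<^sub>1 \<theta>) \<omega> + c)) / 2"

definition S :: "real \<Rightarrow> 'a \<Rightarrow> real" where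
  "S \<theta> \<omega> = cosh (r * (r / 4 * (\<theta> * q\<^sub>0)) + \<bar>c\<bar>) * (1 / cosh (r * Y (q\<^sub>1 \<theta>) \<omega> + c))"

lemma q\<^sub>1: "0 < \<theta> \<Longrightarrow> q\<^sub>0 < q\<^sub>1 \<theta>" "0 < \<theta> \<Longrightarrow> 0 < q\<^sub>1 \<theta>"
  using q\<^sub>0(1) by (auto simp: q\<^sub>1_def add_pos_pos)

lemma P_bounds: "0 \<le> P \<theta> \<omega>" "P \<theta> \<omega> \<le> 1"
  using tanh_real_bounds[of "r * Y (q\<^sub>1 \<theta>) \<omega> + c"] by (auto simp: P_def)

lemma S_nonneg: "0 \<le> S \<theta> \<omega>"
  by (simp add: S_def)

lemma tanh_measurable: "tanh \<in> borel_measurable (borel :: real measure)"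
  by (intro borel_measurable_continuous_onI continuous_intros) auto

lemma cosh_measurable: "cosh \<in> borel_measurable (borel :: real measure)"
  by (intro borel_measurable_continuous_onI continuous_intros)

lemma expectation_P:
  assumes "0 < \<theta>" "z = 0"
  shows "integrable M (P \<theta>)" "expectation (P \<theta>) = p"
proof -
  note [measurable] = tanh_measurable Y_measurable[of "q\<^sub>1 \<theta>"]
  have [measurable]: "Y (q\<^sub>1 \<theta>) \<in> borel_measurable M" using q\<^sub>1[OF assms(1)] by (intro Y_measurable) auto
  have int: "integrable M (\<lambda>\<omega>. tanh (r * Y (q\<^sub>1 \<theta>) \<omega> + c))"
    by (rule integrable_const_bound[of _ 1]) (use tanh_real_bounds in \<open>auto simp: abs_le_iff less_imp_le minus_le_iff\<close>)
  show "integrable M (P \<theta>)" unfolding P_def[abs_def] using int by auto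
  have "expectation (\<lambda>\<omega>. tanh (r * Y (q\<^sub>1 \<theta>) \<omega> + c)) = tanh c"
    using expectation_tanh[of "\<theta> * q\<^sub>0"] assms q\<^sub>0(1) by (simp add: q\<^sub>1_def)
  then have "expectation (P \<theta>) = (1 + tanh c) / 2"
    unfolding P_def[abs_def] using int by (simp add: prob_space)
  also have "tanh c = 2 * p - 1"
  proof -
    have "r * (2 * posterior_prob r p t 0 - 1) = r * tanh c"
      using posterior_mean_eq_tanh[OF p, of r t 0] by (simp add: posterior_mean_def c_def)
    moreover have "posterior_prob r p t 0 = p"
    proof -
      have "p / (1 - p) + 1 = 1 / (1 - p)" using p by (simp add: field_simps)
      then show ?thesis using p by (simp add: posterior_prob_def)
    qed
    ultimately show ?thesis using r by simp
  qed
  finally show "expectation (P \<theta>) = p" by simp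
qed

text \<open>The cosh in \<open>S\<close> grows like exp (r^2 \<open>\<theta>\<close>
  \<open>q\<^sub>0\<close> / 4), while sech decays in mean like exp (- r^2 \<open>\<theta>\<close>
  \<open>q\<^sub>0\<close> / 2). Any level below r / 2 in place of r / 4 would leave some decay; r /
  4 leaves half of it.\<close>

lemma expectation_S:
  assumes "0 < \<theta>" "z = 0"
  shows "integrable M (S \<theta>)" "expectation (S \<theta>) \<le> exp (\<bar>c\<bar> - r\<^sup>2 * \<theta> / 4 * q\<^sub>0)"
proof -
  note [measurable] = cosh_measurable
  have [measurable]: "Y (q\<^sub>1 \<theta>) \<in> borel_measurable M" using q\<^sub>1[OF assms(1)] by (intro Y_measurable) auto
  have int: "integrable M (\<lambda>\<omega>. 1 / cosh (r * Y (q\<^sub>1 \<theta>) \<omega> + c))"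
    by (rule integrable_const_bound[of _ 1]) (use cosh_real_ge_1 in auto)
  then show "integrable M (S \<theta>)" unfolding S_def[abs_def] by (rule integrable_mult_right)
  define x where "x = r * (r / 4 * (\<theta> * q\<^sub>0)) + \<bar>c\<bar>"
  have "0 \<le> x" using assms r q\<^sub>0(1) by (simp add: x_def)
  have "expectation (S \<theta>) = cosh x * expectation (\<lambda>\<omega>. 1 / cosh (r * Y (q\<^sub>1 \<theta>) \<omega> + c))"
    unfolding S_def[abs_def] x_def by (rule integral_mult_right_zero)
  also have "\<dots> = cosh x * (exp (- (r\<^sup>2 / 2) * (\<theta> * q\<^sub>0)) * (1 / cosh c))"
    using expectation_sech[of "\<theta> * q\<^sub>0"] assms q\<^sub>0(1) by (simp add: q\<^sub>1_def)
  also have "\<dots> \<le> exp x * (exp (- (r\<^sup>2 / 2) * (\<theta> * q\<^sub>0)) * 1)"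
  proof (intro mult_mono mult_nonneg_nonneg)
    show "cosh x \<le> exp x" using \<open>0 \<le> x\<close> by (simp add: cosh_def)
    show "1 / cosh c \<le> 1" using cosh_real_ge_1[of c] by simp
  qed auto
  also have "\<dots> = exp (\<bar>c\<bar> - r\<^sup>2 * \<theta> / 4 * q\<^sub>0)"
    by (simp add: x_def power2_eq_square algebra_simps flip: exp_add)
  finally show "expectation (S \<theta>) \<le> exp (\<bar>c\<bar> - r\<^sup>2 * \<theta> / 4 * q\<^sub>0)" .
qed

text \<open>cosh grows with the absolute value of its argument, and the summand for \<open>c\<close>
  in \<open>S\<close> absorbs the shift. So \<open>S\<close> majorizes the indicator of the
  undecided event.\<close>

lemma S_ge_1:
  assumes "\<bar>Y (q\<^sub>1 \<theta>) \<omega>\<bar> \<le> r / 4 * (\<theta> * q\<^sub>0)"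
  shows "1 \<le> S \<theta> \<omega>"
proof -
  define y where "y = Y (q\<^sub>1 \<theta>) \<omega>"
  have "\<bar>r * y + c\<bar> \<le> r * \<bar>y\<bar> + \<bar>c\<bar>" using abs_triangle_ineq[of "r * y" c] r by (simp add: abs_mult)
  also have "\<dots> \<le> r * (r / 4 * (\<theta> * q\<^sub>0)) + \<bar>c\<bar>" using assms r by (simp add: y_def mult_left_mono)
  finally have "cosh \<bar>r * y + c\<bar> \<le> cosh (r * (r / 4 * (\<theta> * q\<^sub>0)) + \<bar>c\<bar>)"
    by (subst cosh_real_nonneg_le_iff) auto
  then show ?thesis
    using cosh_real_pos[of "r * y + c"] by (simp add: S_def y_def cosh_real_abs pos_le_divide_eq)
qed

text \<open>r P is the average of r and the drift. Far from 0 the drift is close to r or - r, so P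
  is close to 1 or 0.\<close>

lemma sign_detected:
  assumes \<theta>: "0 < \<theta>" "\<theta> < 1" and \<rho>: "\<rho> < r" and \<eta>: "\<eta> = r * \<theta> / 8"
    and drift: "\<And>y. l \<le> y \<Longrightarrow> \<rho> \<le> r * tanh (r * y + c)" "\<And>y. y \<le> - l \<Longrightarrow> r * tanh (r * y + c) \<le> - \<rho>"
    and l: "l < \<eta> * q\<^sub>1 \<theta>"
  shows "1 \<le> S \<theta> \<omega> \<or> \<eta> * q\<^sub>1 \<theta> \<le> Y (q\<^sub>1 \<theta>) \<omega> \<and> \<rho> \<le> r * P \<theta> \<omega> \<or>
    Y (q\<^sub>1 \<theta>) \<omega> \<le> - (\<eta> * q\<^sub>1 \<theta>) \<and> r * P \<theta> \<omega> \<le> r - \<rho>"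
proof -
  define y where "y = Y (q\<^sub>1 \<theta>) \<omega>"
  \<comment> \<open>Since \<open>\<theta>\<close> is below 1, \<open>q\<^sub>1 \<theta>\<close> is
    at most \<open>2 * q\<^sub>0\<close>. The 8 in \<open>\<eta>\<close> is this 2 times the 4 of
    the level in \<open>S\<close>.\<close>
  have "(1 + \<theta>) * q\<^sub>0 \<le> 2 * q\<^sub>0" using \<theta> q\<^sub>0(1) by (intro mult_right_mono) auto
  then have "\<eta> * q\<^sub>1 \<theta> \<le> \<eta> * (2 * q\<^sub>0)"
    unfolding q\<^sub>1_def using \<theta> r by (intro mult_left_mono) (auto simp: \<eta> algebra_simps)
  then have le: "\<eta> * q\<^sub>1 \<theta> \<le> r / 4 * (\<theta> * q\<^sub>0)" by (simp add: \<eta> mult_ac)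
  have P: "r * P \<theta> \<omega> = (r + r * tanh (r * y + c)) / 2" by (simp add: P_def y_def distrib_left)
  have half: "x \<ge> \<rho> \<Longrightarrow> \<rho> \<le> (r + x) / 2" "x \<le> - \<rho> \<Longrightarrow> (r + x) / 2 \<le> r - \<rho>" for x
    using \<rho> by simp_all
  consider "\<bar>y\<bar> \<le> r / 4 * (\<theta> * q\<^sub>0)" | "r / 4 * (\<theta> * q\<^sub>0) \<le> y" | "y \<le> - (r / 4 * (\<theta> * q\<^sub>0))"
    by linarith
  then show ?thesis
  proof cases
    case 1
    then show ?thesis using S_ge_1 by (simp add: y_def)
  next
    case 2
    then have "\<eta> * q\<^sub>1 \<theta> \<le> y" using le by linarith
    moreover from this have "\<rho> \<le> r * tanh (r * y + c)" using l by (intro drift(1)) linarith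
    then have "\<rho> \<le> r * P \<theta> \<omega>" unfolding P by (rule half)
    ultimately show ?thesis by (simp add: y_def)
  next
    case 3
    then have "y \<le> - (\<eta> * q\<^sub>1 \<theta>)" using le by linarith
    moreover from this have "r * tanh (r * y + c) \<le> - \<rho>" using l by (intro drift(2)) linarith
    then have "r * P \<theta> \<omega> \<le> r - \<rho>" unfolding P by (rule half)
    ultimately show ?thesis by (simp add: y_def)
  qed
qed

text \<open>The price of waiting: up to \<open>q\<^sub>1 \<theta>\<close> the drift moves Y / q by
  at most \<open>r * \<theta>\<close>.\<close>

lemma clock_start_le:
  assumes "0 < \<theta>" "q\<^sub>0 \<le> q" "q \<le> q\<^sub>1 \<theta>"
  shows "r * (q - q\<^sub>0) \<le> r * \<theta> * q"
proof -
  have "q - q\<^sub>0 \<le> \<theta> * q\<^sub>0" using assms by (simp add: q\<^sub>1_def)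
  also have "\<dots> \<le> \<theta> * q" using assms by (intro mult_left_mono) auto
  finally show ?thesis using r by (simp add: mult.assoc)
qed

lemma clock_later_large:
  assumes "0 < \<theta>" "0 \<le> \<delta>" "0 \<le> min \<eta> \<rho> - 2 * \<delta>" "l < (min \<eta> \<rho> - 2 * \<delta>) * q\<^sub>0"
  shows "l < (min \<eta> \<rho> - 2 * \<delta>) * q\<^sub>1 \<theta>" "l < \<eta> * q\<^sub>1 \<theta>"
proof -
  note q1 = q\<^sub>1[OF assms(1)]
  have "(min \<eta> \<rho> - 2 * \<delta>) * q\<^sub>0 \<le> (min \<eta> \<rho> - 2 * \<delta>) * q\<^sub>1 \<theta>"
    using assms(3) q1 by (intro mult_left_mono) auto
  with assms(4) show *: "l < (min \<eta> \<rho> - 2 * \<delta>) * q\<^sub>1 \<theta>" by linarith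
  have "(min \<eta> \<rho> - 2 * \<delta>) * q\<^sub>1 \<theta> \<le> \<eta> * q\<^sub>1 \<theta>"
    using q1 assms(2) by (intro mult_right_mono) auto
  with * show "l < \<eta> * q\<^sub>1 \<theta>" by linarith
qed

lemma stopping_value_le_of_zero:
  assumes z: "z = 0" and \<theta>: "0 < \<theta>" "\<theta> < 1" and \<rho>: "\<rho> < r" and \<delta>: "0 < \<delta>" and \<eta>: "\<eta> = r * \<theta> / 8"
    and drift: "\<And>y. l \<le> y \<Longrightarrow> \<rho> \<le> r * tanh (r * y + c)" "\<And>y. y \<le> - l \<Longrightarrow> r * tanh (r * y + c) \<le> - \<rho>"
    and large: "0 \<le> min \<eta> \<rho> - 2 * \<delta>" "l < (min \<eta> \<rho> - 2 * \<delta>) * q\<^sub>0"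
  shows "stopping_value M t Z \<le> r * p + (r - \<rho>) + r * \<theta> + (r / \<delta> + 2) * (40 * sqrt (1 - t))
    + r * exp (\<bar>c\<bar> - r\<^sup>2 * \<theta> / 4 * q\<^sub>0)"
proof -
  obtain R where R: "integrable M R" "expectation R \<le> 40 * sqrt (1 - t)" "AE \<omega> in M. regular \<omega> (R \<omega>)"
    by (rule ex_noise_bound)
  note q1 = q\<^sub>1[OF \<theta>(1)] and P = expectation_P[OF \<theta>(1) z] and S = expectation_S[OF \<theta>(1) z]
  note large1 = clock_later_large[OF \<theta>(1) less_imp_le[OF \<delta>] large]
  \<comment> \<open>Each summand pays for one case. With an undecided sign
    \<open>r * S \<theta> \<omega>\<close> is at least \<open>r\<close>; with large noise
    \<open>r / \<delta> * R \<omega>\<close> is; with a positive sign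
    \<open>r * P \<theta> \<omega> + (r - \<rho>)\<close> is. With a negative sign and small noise
    the path never exceeds \<open>r * \<theta> + 2 * R \<omega>\<close>.\<close>
  define B where "B \<omega> = r * P \<theta> \<omega> + (r - \<rho>) + r * \<theta> + (r / \<delta> + 2) * R \<omega> + r * S \<theta> \<omega>" for \<omega>
  have intB: "integrable M B" unfolding B_def[abs_def] using R(1) P(1) S(1) by auto
  have "stopping_value M t Z \<le> expectation B"
  proof (rule stopping_value_le[OF intB])
    show "AE \<omega> in M. \<forall>u\<in>{t..1}. Z u \<omega> \<le> B \<omega>"
      using R(3)
    proof eventually_elim
      case (elim \<omega>)
      note reg = regularD[OF elim]
      have nonneg: "0 \<le> r * P \<theta> \<omega>" "0 \<le> r * \<theta>" "0 \<le> r / \<delta> * R \<omega>" "0 \<le> r * S \<theta> \<omega>"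
        using r \<theta> \<delta> reg(4) P_bounds(1) S_nonneg by simp_all
      have B: "B \<omega> = r * P \<theta> \<omega> + (r - \<rho>) + r * \<theta> + r / \<delta> * R \<omega> + 2 * R \<omega> + r * S \<theta> \<omega>"
        by (simp add: B_def distrib_right)
      show ?case
      proof
        fix u assume u: "u \<in> {t..1}"
        have Zr: "Z u \<omega> \<le> r + 2 * R \<omega>"
          using regular_Z_le[OF elim, of u] u z r by simp
        show "Z u \<omega> \<le> B \<omega>"
        proof (cases "R \<omega> \<le> \<delta>")
          case False
          then have "r \<le> r / \<delta> * R \<omega>" using r \<delta> by (intro le_scaled_excess) auto
          then show ?thesis unfolding B using Zr nonneg \<rho> by linarith
        next
          case True
          consider (undecided) "1 \<le> S \<theta> \<omega>" | (up) "\<eta> * q\<^sub>1 \<theta> \<le> Y (q\<^sub>1 \<theta>) \<omega>" "\<rho> \<le> r * P \<theta> \<omega>"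
            | (down) "Y (q\<^sub>1 \<theta>) \<omega> \<le> - (\<eta> * q\<^sub>1 \<theta>)" "r * P \<theta> \<omega> \<le> r - \<rho>"
            using sign_detected[OF \<theta> \<rho> \<eta> _ _ large1(2), of \<omega>] drift by blast
          then show ?thesis
          proof cases
            case undecided
            then have "r * 1 \<le> r * S \<theta> \<omega>" using r by (intro mult_left_mono) auto
            then show ?thesis unfolding B using Zr nonneg \<rho> by linarith
          next
            case up
            then show ?thesis unfolding B using Zr nonneg \<rho> by linarith
          next
            case down
            have "Y q \<omega> \<le> (r * \<theta> + 2 * R \<omega>) * q" if q: "q\<^sub>0 \<le> q" for q
            proof (cases "q \<le> q\<^sub>1 \<theta>")
              case True
              then show ?thesis
                using regular_upper[OF elim q] clock_start_le[OF \<theta>(1) q] z by (simp add: distrib_right)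
            next
              case False
              have "Y q \<omega> \<le> - (\<eta> * q\<^sub>1 \<theta> + \<rho> * (q - q\<^sub>1 \<theta>) - 2 * \<delta> * q)"
                using q1 False large(1) large1 drift(2) down order_trans[OF reg(5) \<open>R \<omega> \<le> \<delta>\<close>]
                by (intro drift_path_stays_below[OF reg(1)]) auto
              \<comment> \<open>The expression subtracted above is at least
                \<open>(min \<eta> \<rho> - 2 * \<delta>) * q\<close>, hence nonnegative: after the
                decision a negative path stays at or below 0.\<close>
              moreover have "min \<eta> \<rho> * q\<^sub>1 \<theta> \<le> \<eta> * q\<^sub>1 \<theta>" "min \<eta> \<rho> * (q - q\<^sub>1 \<theta>) \<le> \<rho> * (q - q\<^sub>1 \<theta>)"
                using False q1 by (intro mult_right_mono; simp)+
              moreover have "0 \<le> (min \<eta> \<rho> - 2 * \<delta>) * q" "0 \<le> (r * \<theta> + 2 * R \<omega>) * q"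
                using large(1) q q\<^sub>0(1) nonneg(2) reg(4) by auto
              ultimately show ?thesis by (simp add: algebra_simps)
            qed
            then have "Z u \<omega> \<le> r * \<theta> + 2 * R \<omega>" using u by (intro Z_le[OF reg(3)]) auto
            then show ?thesis unfolding B using nonneg \<rho> by linarith
          qed
        qed
      qed
    qed
  qed
  also have "expectation B = r * p + (r - \<rho>) + r * \<theta> + (r / \<delta> + 2) * expectation R + r * expectation (S \<theta>)"
    unfolding B_def[abs_def] using R(1) P S(1) by (simp add: prob_space)
  also have "\<dots> \<le> r * p + (r - \<rho>) + r * \<theta> + (r / \<delta> + 2) * (40 * sqrt (1 - t))
    + r * exp (\<bar>c\<bar> - r\<^sup>2 * \<theta> / 4 * q\<^sub>0)"
    using r \<delta> R(2) S(2) by (intro add_mono mult_left_mono) auto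
  finally show ?thesis .
qed

lemma decision_stopping:
  assumes "t \<le> u" "u \<le> 1"
  shows "(\<lambda>\<omega>. if Z u \<omega> < 0 then u - t else 1 - t) \<in> bridge_stopping_times M t Z"
proof -
  let ?F = "bridge_filtration M t Z" and ?\<tau> = "\<lambda>\<omega>. if Z u \<omega> < 0 then u - t else 1 - t"
  have space: "space (?F s) = space M" for s
    unfolding bridge_filtration_def by (rule space_measure_of) auto
  have "stopping_time ?F ?\<tau>"
  proof (rule stopping_timeI)
    fix s
    \<comment> \<open>The event of having stopped by elapsed time \<open>s\<close> is first empty,
      then the event that \<open>Z u\<close> is negative, then everything.\<close>
    consider "s < u - t" | "u - t \<le> s" "s < 1 - t" | "1 - t \<le> s" by linarith
    then show "Measurable.pred (?F s) (\<lambda>\<omega>. ?\<tau> \<omega> \<le> s)"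
    proof cases
      case 1
      then have "(\<lambda>\<omega>. ?\<tau> \<omega> \<le> s) = (\<lambda>_. False)" using assms by (auto simp: fun_eq_iff)
      then show ?thesis by simp
    next
      case 2
      have "Z (t + (u - t)) -` {..<0} \<inter> space M \<in> sets (?F s)"
        unfolding bridge_filtration_def
        by (subst sets_measure_of) (use 2 assms in \<open>auto intro!: sigma_sets.Basic exI[of _ "u - t"] exI[of _ "{..<0}"]\<close>)
      moreover have "{\<omega> \<in> space (?F s). ?\<tau> \<omega> \<le> s} = Z (t + (u - t)) -` {..<0} \<inter> space M"
        using 2 by (auto simp: space split: if_splits)
      ultimately show ?thesis by (simp add: pred_def)
    next
      case 3
      then have "(\<lambda>\<omega>. ?\<tau> \<omega> \<le> s) = (\<lambda>_. True)" using assms by (auto simp: fun_eq_iff)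
      then show ?thesis by simp
    qed
  qed
  then show ?thesis using assms by (auto simp: bridge_stopping_times_def)
qed

lemma stopping_value_ge_of_zero:
  assumes z: "z = 0" and \<theta>: "0 < \<theta>" "\<theta> < 1" and \<rho>: "\<rho> < r" and \<delta>: "0 < \<delta>" and \<eta>: "\<eta> = r * \<theta> / 8"
    and drift: "\<And>y. l \<le> y \<Longrightarrow> \<rho> \<le> r * tanh (r * y + c)" "\<And>y. y \<le> - l \<Longrightarrow> r * tanh (r * y + c) \<le> - \<rho>"
    and large: "0 \<le> min \<eta> \<rho> - 2 * \<delta>" "l < (min \<eta> \<rho> - 2 * \<delta>) * q\<^sub>0"
  shows "r * p - (r - \<rho>) - r * \<theta> - 2 * \<delta> - (2 * r / \<delta> + 2) * (40 * sqrt (1 - t))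
    - 2 * r * exp (\<bar>c\<bar> - r\<^sup>2 * \<theta> / 4 * q\<^sub>0) \<le> stopping_value M t Z"
proof -
  obtain R where R: "integrable M R" "expectation R \<le> 40 * sqrt (1 - t)" "AE \<omega> in M. regular \<omega> (R \<omega>)"
    by (rule ex_noise_bound)
  note q1 = q\<^sub>1[OF \<theta>(1)] and P = expectation_P[OF \<theta>(1) z] and S = expectation_S[OF \<theta>(1) z]
  note large1 = clock_later_large[OF \<theta>(1) less_imp_le[OF \<delta>] large]
  define u where "u = 1 - 1 / q\<^sub>1 \<theta>"
  have u: "t \<le> u" "u \<le> 1" using clock[of "q\<^sub>1 \<theta>"] q1 by (auto simp: u_def)
  have Zu: "Z u \<omega> = Y (q\<^sub>1 \<theta>) \<omega> / q\<^sub>1 \<theta>" for \<omega> unfolding u_def by (rule Z_eq[OF q1(2)])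
  define \<tau> where "\<tau> \<omega> = (if Z u \<omega> < 0 then u - t else 1 - t)" for \<omega>
  \<comment> \<open>The reward may be as low as - r while r P is near r, hence \<open>2 * r\<close>
    in the terms for large noise and undecided sign. With a positive sign, waiting earns at least
    \<open>\<rho> - 2 * \<delta>\<close>. With a negative sign, r P is at most
    \<open>r - \<rho>\<close> and stopping at \<open>u\<close> earns at least -
    \<open>r * \<theta>\<close> - \<open>2 * R \<omega>\<close>.\<close>
  define B where "B \<omega> = r * P \<theta> \<omega> - (r - \<rho>) - r * \<theta> - 2 * \<delta> - (2 * r / \<delta> + 2) * R \<omega> - 2 * r * S \<theta> \<omega>" for \<omega>
  have intB: "integrable M B" unfolding B_def[abs_def] using R(1) P(1) S(1) by auto
  have "expectation B \<le> stopping_value M t Z"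
  proof (rule stopping_value_ge[OF decision_stopping[OF u] intB])
    show "AE \<omega> in M. B \<omega> \<le> Z (t + (if Z u \<omega> < 0 then u - t else 1 - t)) \<omega>"
      using R(3)
    proof eventually_elim
      case (elim \<omega>)
      note reg = regularD[OF elim]
      have nonneg: "0 \<le> r * \<theta>" "0 \<le> 2 * r / \<delta> * R \<omega>" "0 \<le> 2 * r * S \<theta> \<omega>"
        using r \<theta> \<delta> reg(4) S_nonneg by simp_all
      have "r * P \<theta> \<omega> \<le> r * 1" using P_bounds(2) r by (intro mult_left_mono) auto
      then have Pr: "r * P \<theta> \<omega> \<le> r" by simp
      have B: "B \<omega> = r * P \<theta> \<omega> - (r - \<rho>) - r * \<theta> - 2 * \<delta> - 2 * r / \<delta> * R \<omega> - 2 * R \<omega> - 2 * r * S \<theta> \<omega>"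
        by (simp add: B_def distrib_right)
      have Zr: "- r - 2 * R \<omega> \<le> Z (t + \<tau> \<omega>) \<omega>"
        using regular_Z_ge[OF elim, of "t + \<tau> \<omega>"] u t z r by (simp add: \<tau>_def)
      have "B \<omega> \<le> Z (t + \<tau> \<omega>) \<omega>"
      proof (cases "R \<omega> \<le> \<delta>")
        case False
        then have "2 * r \<le> 2 * r / \<delta> * R \<omega>" using r \<delta> by (intro le_scaled_excess) auto
        then show ?thesis unfolding B using Zr nonneg \<rho> \<delta> Pr by linarith
      next
        case True
        consider (undecided) "1 \<le> S \<theta> \<omega>" | (up) "\<eta> * q\<^sub>1 \<theta> \<le> Y (q\<^sub>1 \<theta>) \<omega>" "\<rho> \<le> r * P \<theta> \<omega>"
          | (down) "Y (q\<^sub>1 \<theta>) \<omega> \<le> - (\<eta> * q\<^sub>1 \<theta>)" "r * P \<theta> \<omega> \<le> r - \<rho>"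
          using sign_detected[OF \<theta> \<rho> \<eta> _ _ large1(2), of \<omega>] drift by blast
        then show ?thesis
        proof cases
          case undecided
          then have "2 * r * 1 \<le> 2 * r * S \<theta> \<omega>" using r by (intro mult_left_mono) auto
          then show ?thesis unfolding B using Zr nonneg \<rho> \<delta> Pr by linarith
        next
          case up
          have "0 \<le> \<eta> * q\<^sub>1 \<theta>" using r \<theta> q1 by (simp add: \<eta>)
          then have "0 \<le> Z u \<omega>" using up(1) q1(2) by (simp add: Zu)
          then have "t + \<tau> \<omega> = 1" by (simp add: \<tau>_def)
          moreover have "\<rho> - 2 * \<delta> \<le> Z 1 \<omega>"
          proof (rule Z_1_ge[OF reg(3), of "q\<^sub>1 \<theta>" "(\<eta> - \<rho>) * q\<^sub>1 \<theta>"])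
            fix q assume "q\<^sub>1 \<theta> \<le> q"
            then have "\<eta> * q\<^sub>1 \<theta> + \<rho> * (q - q\<^sub>1 \<theta>) - 2 * \<delta> * q \<le> Y q \<omega>"
              using q1 large(1) large1 drift(1) up order_trans[OF reg(5) True]
              by (intro drift_path_stays_above[OF reg(1)]) auto
            then show "(\<eta> - \<rho>) * q\<^sub>1 \<theta> + (\<rho> - 2 * \<delta>) * q \<le> Y q \<omega>" by (simp add: algebra_simps)
          qed
          ultimately have "\<rho> - 2 * \<delta> \<le> Z (t + \<tau> \<omega>) \<omega>" by simp
          then show ?thesis unfolding B using nonneg Pr reg(4) by linarith
        next
          case down
          have "0 < \<eta> * q\<^sub>1 \<theta>" using r \<theta> q1 by (simp add: \<eta>)
          then have "Z u \<omega> < 0" using down(1) q1(2) by (simp add: Zu divide_less_0_iff)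
          then have "t + \<tau> \<omega> = u" by (simp add: \<tau>_def)
          moreover have "- (r * \<theta>) - 2 * R \<omega> \<le> Z u \<omega>"
          proof -
            have "(- (r * \<theta>) - 2 * R \<omega>) * q\<^sub>1 \<theta> \<le> Y (q\<^sub>1 \<theta>) \<omega>"
              using regular_lower[OF elim, of "q\<^sub>1 \<theta>"] clock_start_le[OF \<theta>(1), of "q\<^sub>1 \<theta>"] q1 z
              by (simp add: algebra_simps)
            then show ?thesis unfolding Zu using q1(2) by (simp add: pos_le_divide_eq)
          qed
          ultimately have "- (r * \<theta>) - 2 * R \<omega> \<le> Z (t + \<tau> \<omega>) \<omega>" by simp
          then show ?thesis unfolding B using nonneg down(2) \<delta> by linarith
        qed
      qed
      then show ?case by (simp only: \<tau>_def)
    qed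
  qed
  moreover have "expectation B = r * p - (r - \<rho>) - r * \<theta> - 2 * \<delta> - (2 * r / \<delta> + 2) * expectation R - 2 * r * expectation (S \<theta>)"
    unfolding B_def[abs_def] using R(1) P S(1) by (simp add: prob_space)
  moreover have "(2 * r / \<delta> + 2) * expectation R \<le> (2 * r / \<delta> + 2) * (40 * sqrt (1 - t))"
    using r \<delta> R(2) by (intro mult_left_mono) auto
  moreover have "2 * r * expectation (S \<theta>) \<le> 2 * r * exp (\<bar>c\<bar> - r\<^sup>2 * \<theta> / 4 * q\<^sub>0)"
    using r S(2) by (intro mult_left_mono) auto
  ultimately show ?thesis by linarith
qed

end

section \<open>The limit\<close>

lemma tendsto_of_eventually_bounds:
  fixes f :: "'b \<Rightarrow> real"
  assumes upper: "\<And>e. 0 < e \<Longrightarrow> eventually (\<lambda>x. f x \<le> L + e) F"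
    and lower: "\<And>e. 0 < e \<Longrightarrow> eventually (\<lambda>x. L - e \<le> f x) F"
  shows "(f \<longlongrightarrow> L) F"
proof (rule order_tendstoI)
  show "eventually (\<lambda>x. a < f x) F" if "a < L" for a
    using lower[of "(L - a) / 2"] that by (auto elim!: eventually_mono simp: field_simps)
  show "eventually (\<lambda>x. f x < a) F" if "L < a" for a
    using upper[of "(a - L) / 2"] that by (auto elim!: eventually_mono simp: field_simps)
qed

section \<open>Error terms near time 1\<close>

lemma eventually_sqrt_le:
  assumes "0 < e"
  shows "eventually (\<lambda>t. K * (40 * sqrt (1 - t)) \<le> e) (at_left (1 :: real))"
proof -
  have "((\<lambda>t. K * (40 * sqrt (1 - t))) \<longlongrightarrow> K * (40 * sqrt (1 - 1))) (at_left (1 :: real))"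
    by (intro tendsto_intros)
  then have "eventually (\<lambda>t. K * (40 * sqrt (1 - t)) < e) (at_left (1 :: real))"
    using assms by (intro order_tendstoD) auto
  then show ?thesis by (rule eventually_mono) simp
qed

lemma clock_at_top: "filterlim (\<lambda>t. 1 / (1 - t)) at_top (at_left (1 :: real))"
proof -
  have "((\<lambda>t. 1 - t) \<longlongrightarrow> 1 - 1) (at_left (1 :: real))" by (intro tendsto_intros)
  moreover have "eventually (\<lambda>t. 0 < 1 - t) (at_left (1 :: real))"
    using eventually_at_left_real[of 0 1] by (auto elim: eventually_mono)
  ultimately have "filterlim (\<lambda>t. 1 - t) (at_right 0) (at_left (1 :: real))"
    by (auto simp: filterlim_at elim: eventually_mono)
  from filterlim_compose[OF filterlim_inverse_at_top_right this]
  show ?thesis by (simp add: inverse_eq_divide)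
qed

lemma eventually_clock_large:
  assumes "0 < m"
  shows "eventually (\<lambda>t. l < m * (1 / (1 - t))) (at_left (1 :: real))"
proof -
  have "eventually (\<lambda>t. l / m < 1 / (1 - t)) (at_left (1 :: real))"
    using clock_at_top by (auto simp: filterlim_at_top_dense)
  then show ?thesis by (rule eventually_mono) (use assms in \<open>simp add: field_simps\<close>)
qed

lemma eventually_exp_clock_le:
  assumes "0 < b" "0 < e"
  shows "eventually (\<lambda>t. K * exp (a - b * (1 / (1 - t))) \<le> e) (at_left (1 :: real))"
proof -
  have "filterlim (\<lambda>t. - a + b * (1 / (1 - t))) at_top (at_left (1 :: real))"
    by (intro filterlim_tendsto_add_at_top[OF tendsto_const]
        filterlim_tendsto_pos_mult_at_top[OF tendsto_const assms(1) clock_at_top])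
  then have "filterlim (\<lambda>t. - (- a + b * (1 / (1 - t)))) at_bot (at_left (1 :: real))"
    by (simp only: filterlim_uminus_at_top)
  then have "((\<lambda>t. exp (a - b * (1 / (1 - t)))) \<longlongrightarrow> 0) (at_left (1 :: real))"
    by (intro filterlim_compose[OF exp_at_bot]) simp
  then have "((\<lambda>t. K * exp (a - b * (1 / (1 - t)))) \<longlongrightarrow> K * 0) (at_left (1 :: real))"
    by (intro tendsto_intros)
  then have "eventually (\<lambda>t. K * exp (a - b * (1 / (1 - t))) < e) (at_left (1 :: real))"
    using assms by (intro order_tendstoD) auto
  then show ?thesis by (rule eventually_mono) simp
qed

lemma drift_level:
  fixes r e :: real
  assumes "0 < r" "0 < e"
  obtains \<rho> l where "0 < \<rho>" "\<rho> < r" "r - \<rho> \<le> e"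
    "\<And>y. l \<le> y \<Longrightarrow> \<rho> \<le> r * tanh (r * y + c)" "\<And>y. y \<le> - l \<Longrightarrow> r * tanh (r * y + c) \<le> - \<rho>"
proof -
  \<comment> \<open>The alternative r / 2 keeps \<open>\<rho>\<close> positive when \<open>e\<close>
    exceeds \<open>r\<close>.\<close>
  define \<rho> where "\<rho> = max (r / 2) (r - e)"
  have \<rho>: "0 < \<rho>" "\<rho> < r" "r - \<rho> \<le> e" using assms by (auto simp: \<rho>_def)
  show thesis
    by (rule tanh_threshold[OF assms(1) \<rho>(2), of c]) (rule that[OF \<rho>])
qed

context
  fixes r p z :: real and M :: "real \<Rightarrow> 'a measure" and W Z :: "real \<Rightarrow> real \<Rightarrow> 'a \<Rightarrow> real"
  assumes bridge: "\<And>t. 0 \<le> t \<Longrightarrow> t < 1 \<Longrightarrow> bridge r p t z (M t) (W t) (Z t)"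
begin

abbreviation (input) "V t \<equiv> stopping_value (M t) t (Z t)"

lemma eventually_bridge: "eventually (\<lambda>t. bridge r p t z (M t) (W t) (Z t)) (at_left 1)"
  using eventually_at_left_real[of 0 1] by (auto elim!: eventually_mono intro: bridge)

lemma r_pos: "0 < r"
  using bridge[of 0] by (simp add: bridge_def)

lemma eventually_value_le_max:
  assumes "0 < e"
  shows "eventually (\<lambda>t. V t \<le> max z r + e) (at_left 1)"
  using eventually_bridge eventually_sqrt_le[OF assms, of 2]
proof eventually_elim
  case (elim t)
  then show ?case using bridge.stopping_value_le_max[OF elim(1)] by linarith
qed

lemma eventually_value_ge_start: "eventually (\<lambda>t. z \<le> V t) (at_left 1)"
  using eventually_bridge by eventually_elim (rule bridge.stopping_value_ge_start)

lemma eventually_value_ge_lower_pin: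
  assumes "0 < e"
  shows "eventually (\<lambda>t. - r - e \<le> V t) (at_left 1)"
  using eventually_bridge eventually_sqrt_le[OF assms, of 2]
proof eventually_elim
  case (elim t)
  then show ?case using bridge.stopping_value_ge_lower_pin[OF elim(1)] by linarith
qed

lemma eventually_value_le_of_negative:
  assumes "z < 0" "0 < e"
  shows "eventually (\<lambda>t. V t \<le> max z (- r) + e) (at_left 1)"
proof -
  have e3: "0 < e / 3" using assms by simp
  obtain \<rho> l where \<rho>: "0 < \<rho>" "\<rho> < r" "r - \<rho> \<le> e / 3"
    and drift: "\<And>y. l \<le> y \<Longrightarrow> \<rho> \<le> r * tanh (r * y + half_log_odds p)"
      "\<And>y. y \<le> - l \<Longrightarrow> r * tanh (r * y + half_log_odds p) \<le> - \<rho>"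
    by (rule drift_level[OF r_pos e3, of "half_log_odds p"]) blast
  \<comment> \<open>\<open>e / 6\<close> keeps the loss \<open>2 * \<delta>\<close> within a third
    of \<open>e\<close>; the quarter leaves at least half of \<open>min (- z) \<rho>\<close> as a
    positive slope, which the growing clock lifts above \<open>l\<close>.\<close>
  define \<delta> where "\<delta> = min (e / 6) (min (- z) \<rho> / 4)"
  have \<delta>: "0 < \<delta>" "2 * \<delta> \<le> e / 3" "0 < min (- z) \<rho> - 2 * \<delta>"
    using assms \<rho> by (auto simp: \<delta>_def min_def)
  show ?thesis
    using eventually_bridge eventually_clock_large[OF \<delta>(3), of l]
      eventually_sqrt_le[OF e3, of "(2 * \<bar>z\<bar> + r) / \<delta> + 2"]
  proof eventually_elim
    case (elim t)
    interpret bridge r p t z "M t" "W t" "Z t" by fact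
    have "V t \<le> max z (- \<rho>) + 2 * \<delta> + ((2 * \<bar>z\<bar> + r) / \<delta> + 2) * (40 * sqrt (1 - t))"
      using elim \<delta> drift assms by (intro stopping_value_le_of_negative[of \<delta> l]) (auto simp: c_def q\<^sub>0_def)
    moreover have "max z (- \<rho>) \<le> max z (- r) + e / 3" using \<rho> \<open>0 < e\<close> by linarith
    ultimately show ?case using elim(3) \<delta>(2) by linarith
  qed
qed

lemma eventually_value_ge_of_positive:
  assumes "0 < z" "0 < e"
  shows "eventually (\<lambda>t. r - e \<le> V t) (at_left 1)"
proof -
  have e3: "0 < e / 3" using assms by simp
  obtain \<rho> l where \<rho>: "0 < \<rho>" "\<rho> < r" "r - \<rho> \<le> e / 3"
    and drift: "\<And>y. l \<le> y \<Longrightarrow> \<rho> \<le> r * tanh (r * y + half_log_odds p)"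
      "\<And>y. y \<le> - l \<Longrightarrow> r * tanh (r * y + half_log_odds p) \<le> - \<rho>"
    by (rule drift_level[OF r_pos e3, of "half_log_odds p"]) blast
  define \<delta> where "\<delta> = min (e / 6) (min z \<rho> / 4)"
  have \<delta>: "0 < \<delta>" "2 * \<delta> \<le> e / 3" "0 < min z \<rho> - 2 * \<delta>"
    using assms \<rho> by (auto simp: \<delta>_def min_def)
  show ?thesis
    using eventually_bridge eventually_clock_large[OF \<delta>(3), of l]
      eventually_sqrt_le[OF e3, of "2 * r / \<delta> + 2"]
  proof eventually_elim
    case (elim t)
    interpret bridge r p t z "M t" "W t" "Z t" by fact
    have "\<rho> - 2 * \<delta> - (2 * r / \<delta> + 2) * (40 * sqrt (1 - t)) \<le> V t"
      using elim \<delta> drift assms \<rho> by (intro stopping_value_ge_of_positive[of \<delta> \<rho> l]) (auto simp: c_def q\<^sub>0_def)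
    then show ?case using elim(3) \<delta>(2) \<rho>(3) by linarith
  qed
qed

lemma eventually_value_of_zero:
  assumes "z = 0" "0 < e"
  shows "eventually (\<lambda>t. V t \<le> p * r + e) (at_left 1)"
    and "eventually (\<lambda>t. p * r - e \<le> V t) (at_left 1)"
proof -
  have e5: "0 < e / 5" using assms by simp
  obtain \<rho> l where \<rho>: "0 < \<rho>" "\<rho> < r" "r - \<rho> \<le> e / 5"
    and drift: "\<And>y. l \<le> y \<Longrightarrow> \<rho> \<le> r * tanh (r * y + half_log_odds p)"
      "\<And>y. y \<le> - l \<Longrightarrow> r * tanh (r * y + half_log_odds p) \<le> - \<rho>"
    by (rule drift_level[OF r_pos e5, of "half_log_odds p"]) blast
  \<comment> \<open>The waiting fraction is fixed before \<open>\<delta>\<close> and before t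
    approaches 1: it makes \<open>r * \<theta>\<close> at most a fifth of \<open>e\<close>, and for
    fixed \<open>\<theta>\<close> the exponential error still vanishes as the clock grows. The
    alternative 1 / 2 keeps \<open>\<theta>\<close> below 1.\<close>
  define \<theta> where "\<theta> = min (1 / 2) (e / (5 * r))"
  have \<theta>: "0 < \<theta>" "\<theta> < 1" using assms r_pos by (auto simp: \<theta>_def)
  have "r * \<theta> \<le> r * (e / (5 * r))" using r_pos by (intro mult_left_mono) (auto simp: \<theta>_def)
  then have r\<theta>: "r * \<theta> \<le> e / 5" using r_pos by simp
  define \<eta> where "\<eta> = r * \<theta> / 8"
  have "0 < \<eta>" using r_pos \<theta> by (simp add: \<eta>_def)
  define \<delta> where "\<delta> = min (e / 10) (min \<eta> \<rho> / 4)"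
  have \<delta>: "0 < \<delta>" "2 * \<delta> \<le> e / 5" "0 < min \<eta> \<rho> - 2 * \<delta>"
    using assms \<rho> \<open>0 < \<eta>\<close> by (auto simp: \<delta>_def min_def)
  have b: "0 < r\<^sup>2 * \<theta> / 4" using r_pos \<theta> by simp
  define a where "a = \<bar>half_log_odds p\<bar>"
  show "eventually (\<lambda>t. V t \<le> p * r + e) (at_left 1)"
    using eventually_bridge eventually_clock_large[OF \<delta>(3), of l]
      eventually_sqrt_le[OF e5, of "r / \<delta> + 2"] eventually_exp_clock_le[OF b e5, of r a]
  proof eventually_elim
    case (elim t)
    interpret bridge r p t z "M t" "W t" "Z t" by fact
    have "V t \<le> r * p + (r - \<rho>) + r * \<theta> + (r / \<delta> + 2) * (40 * sqrt (1 - t))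
        + r * exp (\<bar>c\<bar> - r\<^sup>2 * \<theta> / 4 * q\<^sub>0)"
      using elim \<delta> drift \<theta> \<rho> assms
      by (intro stopping_value_le_of_zero[of \<theta> \<rho> \<delta> \<eta> l]) (auto simp: c_def q\<^sub>0_def \<eta>_def)
    then have "V t \<le> r * p + e / 5 + e / 5 + e / 5 + e / 5"
      using elim(3,4) \<rho>(3) r\<theta> unfolding c_def q\<^sub>0_def a_def by linarith
    then show ?case using \<open>0 < e\<close> by (simp add: mult.commute)
  qed
  show "eventually (\<lambda>t. p * r - e \<le> V t) (at_left 1)"
    using eventually_bridge eventually_clock_large[OF \<delta>(3), of l]
      eventually_sqrt_le[OF e5, of "2 * r / \<delta> + 2"] eventually_exp_clock_le[OF b e5, of "2 * r" a]
  proof eventually_elim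
    case (elim t)
    interpret bridge r p t z "M t" "W t" "Z t" by fact
    have "r * p - (r - \<rho>) - r * \<theta> - 2 * \<delta> - (2 * r / \<delta> + 2) * (40 * sqrt (1 - t))
        - 2 * r * exp (\<bar>c\<bar> - r\<^sup>2 * \<theta> / 4 * q\<^sub>0) \<le> V t"
      using elim \<delta> drift \<theta> \<rho> assms
      by (intro stopping_value_ge_of_zero[of \<theta> \<rho> \<delta> \<eta> l]) (auto simp: c_def q\<^sub>0_def \<eta>_def)
    then have "r * p - e / 5 - e / 5 - e / 5 - e / 5 - e / 5 \<le> V t"
      using elim(3,4) \<rho>(3) r\<theta> \<delta>(2) unfolding c_def q\<^sub>0_def a_def by linarith
    then show ?case by (simp add: mult.commute)
  qed
qed

lemma value_tendsto:
  "((\<lambda>t. V t) \<longlongrightarrow> (if z < 0 then max z (- r) else if z = 0 then p * r else max z r)) (at_left 1)"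
proof (cases z "0 :: real" rule: linorder_cases)
  case less
  have "((\<lambda>t. V t) \<longlongrightarrow> max z (- r)) (at_left 1)"
  proof (rule tendsto_of_eventually_bounds)
    fix e :: real assume e: "0 < e"
    show "eventually (\<lambda>t. V t \<le> max z (- r) + e) (at_left 1)"
      by (rule eventually_value_le_of_negative[OF less e])
    \<comment> \<open>Stopping at once secures z, and waiting until time 1 secures nearly -
      r.\<close>
    show "eventually (\<lambda>t. max z (- r) - e \<le> V t) (at_left 1)"
      using eventually_value_ge_start eventually_value_ge_lower_pin[OF e]
      by eventually_elim (use e in linarith)
  qed
  then show ?thesis using less by simp
next
  case equal
  then have "((\<lambda>t. V t) \<longlongrightarrow> p * r) (at_left 1)"
    by (intro tendsto_of_eventually_bounds eventually_value_of_zero)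
  then show ?thesis using equal by simp
next
  case greater
  have "((\<lambda>t. V t) \<longlongrightarrow> max z r) (at_left 1)"
  proof (rule tendsto_of_eventually_bounds)
    fix e :: real assume e: "0 < e"
    show "eventually (\<lambda>t. V t \<le> max z r + e) (at_left 1)"
      by (rule eventually_value_le_max[OF e])
    show "eventually (\<lambda>t. max z r - e \<le> V t) (at_left 1)"
      using eventually_value_ge_start eventually_value_ge_of_positive[OF greater e]
      by eventually_elim (use e in linarith)
  qed
  then show ?thesis using greater by simp
qed

end

theorem proposition4p3:
  fixes r p :: real
    and M :: "real \<Rightarrow> real \<Rightarrow> 'a measure"
    and W Z :: "real \<Rightarrow> real \<Rightarrow> real \<Rightarrow> 'a \<Rightarrow> real"
    and v :: "real \<Rightarrow> real \<Rightarrow> real"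
    and z :: real
  assumes "0 < r" and "0 < p" and "p < 1"
    and sol: "\<And>t y. 0 \<le> t \<Longrightarrow> t < 1 \<Longrightarrow> bridge_solution r p t y (M t y) (W t y) (Z t y)"
    and value_fun: "\<And>t y. 0 \<le> t \<Longrightarrow> t < 1 \<Longrightarrow> v t y = stopping_value (M t y) t (Z t y)"
  shows "((\<lambda>t. v t z) \<longlongrightarrow>
            - r * indicator {..<- r} z + z * indicator {- r..<0} z + p * r * indicator {0} z
            + r * indicator {0<..r} z + z * indicator {r<..} z) (at_left 1)"
proof -
  have "bridge r p t z (M t z) (W t z) (Z t z)" if "0 \<le> t" "t < 1" for t
    using assms(1-3) that sol by (simp add: bridge_def)
  then have "((\<lambda>t. stopping_value (M t z) t (Z t z)) \<longlongrightarrow>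
      (if z < 0 then max z (- r) else if z = 0 then p * r else max z r)) (at_left 1)"
    by (rule value_tendsto)
  moreover have "eventually (\<lambda>t. stopping_value (M t z) t (Z t z) = v t z) (at_left 1)"
    using eventually_at_left_real[of 0 1] by (auto elim!: eventually_mono simp: value_fun)
  moreover have "(if z < 0 then max z (- r) else if z = 0 then p * r else max z r)
      = - r * indicator {..<- r} z + z * indicator {- r..<0} z + p * r * indicator {0} z
            + r * indicator {0<..r} z + z * indicator {r<..} z"
    using \<open>0 < r\<close> by (auto simp: indicator_def max_def)
  ultimately show ?thesis by (simp add: Lim_transform_eventually)
qed

end
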